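(* Let $\mathcal{C}$ be a covering of a finite set $U$ with $|U|=m$, such that there are no two distinct elements $u,v\in U$ with $\mathcal{C}(\{u\})=\mathcal{C}(\{v\})$ and $|\mathcal{C}(\{u\})|=1$. Let $G$ be a finite group, $n\geq 0$ an integer, and $Q_n(G)$ the Dowling lattice. If $L(\mathcal{C})\cong Q_n(G)$, then either $n\in\{0,1\}$ or $n=2$. In the case $n=2$, we must have $m=|G|+2$ and $k=1$, where $k:=|\mathcal{E}|$.
   Context: A covering of a finite set $U$ is a collection $\mathcal{C}\subseteq 2^U$ of subsets of $U$ whose union is $U$. For $H\subseteq U$, $\mathcal{C}(H):=\{C\in\mathcal{C} : C\cap H\neq\emptyset\}$. The matroid $M(\mathcal{C})$ is the transversal matroid of $\mathcal{C}$ on the ground set $U$: its independent sets are the partial transversals of $\mathcal{C}$, i.e. the sets $I\subseteq U$ for which there is an injective map $\varphi:I\to\mathcal{C}$ with $e\in\varphi(e)$ for all $e\in I$. $L(\mathcal{C})$ is the lattice of closed sets (flats) of $M(\mathcal{C})$ ordered by inclusion. For $x\in U$ with $|\mathcal{C}(\{x\})|=2$, $E(\{x\}):=\{y\in U : \mathcal{C}(\{y\})\subseteq\mathcal{C}(\{x\})\}$, and $\mathcal{E}:=\{E(\{x\}) : x\in U,\ |\mathcal{C}(\{x\})|=2\}$. Dowling lattice $Q_n(G)$: let $N=\{1,\dots,n\}$. A partial $G$-partition of $N$ is data $(Z;(B_1,a_1),\dots,(B_t,a_t))$ where $Z\subseteq N$ (the zero block), $\{B_1,\dots,B_t\}$ is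 a partition of $N\setminus Z$ into nonempty blocks, and each $a_i:B_i\to G$ is a function. Two such data are identified if they have the same zero block and the same nonzero blocks, and on each nonzero block $B$ the two labelings $a,a'$ satisfy $a'(x)=g\,a(x)$ for all $x\in B$, for some $g\in G$ (depending on $B$). The elements of $Q_n(G)$ are the resulting equivalence classes. The order is: $[(Z;(B_1,a_1),\dots,(B_t,a_t))]\leq[(Z';(C_1,b_1),\dots,(C_r,b_r))]$ if $Z\subseteq Z'$, each $C_j$ is a union of blocks among $B_1,\dots,B_t$, and for every $B_i\subseteq C_j$ there is $g_i\in G$ with $b_j(x)=g_i\,a_i(x)$ for all $x\in B_i$. *)

theory Defs
  imports "HOL-Algebra.Group" "HOL-Algebra.Order" "HOL-Library.Disjoint_Sets"
begin

section \<open>Isomorphic orders\<close>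

definition order_isomorphic ::
    "('a, 'c) gorder_scheme \<Rightarrow> ('b, 'd) gorder_scheme \<Rightarrow> bool" where
  "order_isomorphic A B \<longleftrightarrow>
     (\<exists>f. bij_betw f (carrier A) (carrier B) \<and> order_emb A B f)"


section \<open>Rank, closure and flats of a matroid given by its independent sets\<close>

definition matroid_rank :: "('a set \<Rightarrow> bool) \<Rightarrow> 'a set \<Rightarrow> nat" where
  "matroid_rank indep X = Max (card ` {I. I \<subseteq> X \<and> indep I})"

definition matroid_closure :: "'a set \<Rightarrow> ('a set \<Rightarrow> bool) \<Rightarrow> 'a set \<Rightarrow> 'a set" where
  "matroid_closure U indep X = {x \<in> U. matroid_rank indep (insert x X) = matroid_rank indep X}"

definition matroid_flats :: "'a set \<Rightarrow> ('a set \<Rightarrow> bool) \<Rightarrow> 'a set set" where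
  "matroid_flats U indep = {F. F \<subseteq> U \<and> matroid_closure U indep F = F}"


section \<open>Coverings and their transversal matroids\<close>

definition covering :: "'a set \<Rightarrow> 'a set set \<Rightarrow> bool" where
  "covering U \<C> \<longleftrightarrow> \<C> \<subseteq> Pow U \<and> \<Union>\<C> = U"

definition cov_meeting :: "'a set set \<Rightarrow> 'a set \<Rightarrow> 'a set set" where
  "cov_meeting \<C> H = {C \<in> \<C>. C \<inter> H \<noteq> {}}"

definition transversal_indep :: "'a set \<Rightarrow> 'a set set \<Rightarrow> 'a set \<Rightarrow> bool" where
  "transversal_indep U \<C> I \<longleftrightarrow>
     I \<subseteq> U \<and> (\<exists>\<phi>. inj_on \<phi> I \<and> (\<forall>e\<in>I. \<phi> e \<in> \<C> \<and> e \<in> \<phi> e))"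

definition flat_lattice :: "'a set \<Rightarrow> 'a set set \<Rightarrow> 'a set gorder" where
  "flat_lattice U \<C> =
     \<lparr>carrier = matroid_flats U (transversal_indep U \<C>), eq = (=), le = (\<subseteq>)\<rparr>"

definition cov_E :: "'a set \<Rightarrow> 'a set set \<Rightarrow> 'a \<Rightarrow> 'a set" where
  "cov_E U \<C> x = {y \<in> U. cov_meeting \<C> {y} \<subseteq> cov_meeting \<C> {x}}"

definition cov_Es :: "'a set \<Rightarrow> 'a set set \<Rightarrow> 'a set set" where
  "cov_Es U \<C> = {cov_E U \<C> x | x. x \<in> U \<and> card (cov_meeting \<C> {x}) = 2}"


section \<open>Dowling lattices\<close>

text \<open>The datum \<open>(Z; (B\<^sub>1,a\<^sub>1), \<dots>, (B\<^sub>t,a\<^sub>t))\<close> is encoded as \<open>(Z, {(B\<^sub>1,a\<^sub>1), \<dots>, (B\<^sub>t,a\<^sub>t)})\<close>;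
  injectivity of \<^const>\<open>fst\<close> says that every block carries exactly one labeling, and labelings are
  extensional functions, so that each is determined by its values on its block.\<close>

type_synonym 'g gpart = "nat set \<times> (nat set \<times> (nat \<Rightarrow> 'g)) set"

definition partial_G_partitions :: "nat \<Rightarrow> ('g, 'm) monoid_scheme \<Rightarrow> 'g gpart set" where
  "partial_G_partitions n G =
     {(Z, S). Z \<subseteq> {1..n} \<and> partition_on ({1..n} - Z) (fst ` S) \<and> inj_on fst S \<and>
              (\<forall>(B, a)\<in>S. a \<in> B \<rightarrow>\<^sub>E carrier G)}"

definition gpart_rel :: "nat \<Rightarrow> ('g, 'm) monoid_scheme \<Rightarrow> 'g gpart rel" where
  "gpart_rel n G =
     {((Z, S), (Z', S')).
        (Z, S) \<in> partial_G_partitions n G \<and> (Z', S') \<in> partial_G_partitions n G \<and>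
        Z = Z' \<and> fst ` S = fst ` S' \<and>
        (\<forall>(B, a)\<in>S. \<forall>(B', a')\<in>S'. B = B' \<longrightarrow>
           (\<exists>g\<in>carrier G. \<forall>x\<in>B. a' x = g \<otimes>\<^bsub>G\<^esub> a x))}"

definition gpart_le :: "('g, 'm) monoid_scheme \<Rightarrow> 'g gpart \<Rightarrow> 'g gpart \<Rightarrow> bool" where
  "gpart_le G = (\<lambda>(Z, S) (Z', S').
     Z \<subseteq> Z' \<and>
     (\<forall>(C, b)\<in>S'.
        (\<exists>\<B> \<subseteq> fst ` S. C = \<Union>\<B>) \<and>
        (\<forall>(B, a)\<in>S. B \<subseteq> C \<longrightarrow> (\<exists>g\<in>carrier G. \<forall>x\<in>B. b x = g \<otimes>\<^bsub>G\<^esub> a x))))"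

text \<open>For a group \<open>G\<close> the order does not depend on the representatives; see
  \<open>gpart_le_respects\<close> below.\<close>

definition dowling_lattice :: "nat \<Rightarrow> ('g, 'm) monoid_scheme \<Rightarrow> 'g gpart set gorder" where
  "dowling_lattice n G =
     \<lparr>carrier = partial_G_partitions n G // gpart_rel n G, eq = (=),
      le = (\<lambda>X Y. \<exists>p\<in>X. \<exists>q\<in>Y. gpart_le G p q)\<rparr>"


section \<open>The orders are partial orders\<close>

lemma part_block_eq:
  assumes "partition_on A P" "B \<in> P" "C \<in> P" "x \<in> B" "x \<in> C"
  shows "B = C"
  using disjointD[OF partition_onD2[OF assms(1)] assms(2,3)] assms(4,5) by blast

lemma part_block_sub:
  assumes "partition_on A P" "B \<in> P" "C \<in> P" "B \<subseteq> C"
  shows "B = C"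
proof -
  obtain x where "x \<in> B" using partition_onD3[OF assms(1)] assms(2) by (metis all_not_in_conv)
  then show ?thesis using part_block_eq[OF assms(1-3)] assms(4) by blast
qed

lemma partial_order_flat_lattice: "partial_order (flat_lattice U \<C>)"
  by unfold_locales (auto simp: flat_lattice_def)

context group
begin

lemma gpart_label_closed:
  assumes "(Z, S) \<in> partial_G_partitions n G" "(B, a) \<in> S" "x \<in> B"
  shows "a x \<in> carrier G"
  using assms by (fastforce simp: partial_G_partitions_def)

lemma gpart_label_unique:
  assumes "(Z, S) \<in> partial_G_partitions n G" "(B, a) \<in> S" "(B, b) \<in> S"
  shows "a = b"
  using assms by (fastforce simp: partial_G_partitions_def inj_on_def)

lemma prop_refl:
  assumes "\<And>x. x \<in> B \<Longrightarrow> a x \<in> carrier G"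
  shows "\<exists>g\<in>carrier G. \<forall>x\<in>B. a x = g \<otimes> a x"
  using assms by (intro bexI[of _ \<one>]) auto

lemma prop_sym:
  assumes "\<And>x. x \<in> B \<Longrightarrow> a x \<in> carrier G" "\<exists>g\<in>carrier G. \<forall>x\<in>B. b x = g \<otimes> a x"
  shows "\<exists>g\<in>carrier G. \<forall>x\<in>B. a x = g \<otimes> b x"
proof -
  obtain g where "g \<in> carrier G" "\<forall>x\<in>B. b x = g \<otimes> a x"
    using assms(2) by blast
  then show ?thesis
    using assms(1) by (intro bexI[of _ "inv g"]) (auto simp: m_assoc[symmetric])
qed

lemma prop_trans:
  assumes "\<And>x. x \<in> B \<Longrightarrow> a x \<in> carrier G"
    and "\<exists>g\<in>carrier G. \<forall>x\<in>B. b x = g \<otimes> a x" "\<exists>g\<in>carrier G. \<forall>x\<in>B. c x = g \<otimes> b x"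
  shows "\<exists>g\<in>carrier G. \<forall>x\<in>B. c x = g \<otimes> a x"
proof -
  obtain g h where "g \<in> carrier G" "\<forall>x\<in>B. b x = g \<otimes> a x" "h \<in> carrier G" "\<forall>x\<in>B. c x = h \<otimes> b x"
    using assms(2,3) by blast
  then show ?thesis
    using assms(1) by (intro bexI[of _ "h \<otimes> g"]) (auto simp: m_assoc)
qed

lemma fst_memI: "(B, a) \<in> S \<Longrightarrow> B \<in> fst ` S"
  by force

lemma gpart_relD:
  assumes "((Z, S), (Z', S')) \<in> gpart_rel n G"
  shows "(Z, S) \<in> partial_G_partitions n G" "(Z', S') \<in> partial_G_partitions n G"
    "Z = Z'" "fst ` S = fst ` S'"
    and "\<And>B a b. (B, a) \<in> S \<Longrightarrow> (B, b) \<in> S' \<Longrightarrow> \<exists>g\<in>carrier G. \<forall>x\<in>B. b x = g \<otimes> a x"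
  using assms unfolding gpart_rel_def by (blast, blast, blast, blast, fast)

lemma gpart_relI:
  assumes "(Z, S) \<in> partial_G_partitions n G" "(Z', S') \<in> partial_G_partitions n G"
    "Z = Z'" "fst ` S = fst ` S'"
    and "\<And>B a b. (B, a) \<in> S \<Longrightarrow> (B, b) \<in> S' \<Longrightarrow> \<exists>g\<in>carrier G. \<forall>x\<in>B. b x = g \<otimes> a x"
  shows "((Z, S), (Z', S')) \<in> gpart_rel n G"
  unfolding gpart_rel_def mem_Collect_eq case_prod_conv
  by (intro conjI ballI assms(1-4)) (use assms(5) in \<open>simp split: prod.splits, intro allI impI ballI, simp\<close>)

lemma gpart_leI:
  assumes "Z \<subseteq> Z'" "\<And>C b. (C, b) \<in> S' \<Longrightarrow> \<exists>\<B> \<subseteq> fst ` S. C = \<Union>\<B>"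
    and "\<And>B C a b. (C, b) \<in> S' \<Longrightarrow> (B, a) \<in> S \<Longrightarrow> B \<subseteq> C \<Longrightarrow>
           \<exists>g\<in>carrier G. \<forall>x\<in>B. b x = g \<otimes> a x"
  shows "gpart_le G (Z, S) (Z', S')"
  unfolding gpart_le_def case_prod_conv
  by (intro conjI ballI assms(1)) (use assms(2,3) in \<open>simp split: prod.splits, intro allI impI ballI conjI, simp_all\<close>)

lemma gpart_leD:
  assumes "gpart_le G (Z, S) (Z', S')"
  shows "Z \<subseteq> Z'" "C \<in> fst ` S' \<Longrightarrow> \<exists>\<B> \<subseteq> fst ` S. C = \<Union>\<B>"
    and "(C, b) \<in> S' \<Longrightarrow> (B, a) \<in> S \<Longrightarrow> B \<subseteq> C \<Longrightarrow>
           \<exists>g\<in>carrier G. \<forall>x\<in>B. b x = g \<otimes> a x"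
proof -
  note le = assms[unfolded gpart_le_def case_prod_conv]
  show "Z \<subseteq> Z'" using le by (rule conjunct1)
  show "\<exists>\<B> \<subseteq> fst ` S. C = \<Union>\<B>" if "C \<in> fst ` S'"
  proof -
    obtain b where "(C, b) \<in> S'" using \<open>C \<in> fst ` S'\<close> by force
    from bspec[OF conjunct2[OF le] this] show ?thesis by simp
  qed
  show "\<exists>g\<in>carrier G. \<forall>x\<in>B. b x = g \<otimes> a x" if "(C, b) \<in> S'" "(B, a) \<in> S" "B \<subseteq> C"
    using bspec[OF conjunct2[OF le] that(1)] that(2,3) by fastforce
qed

lemma gpart_le_refl:
  assumes "p \<in> partial_G_partitions n G"
  shows "gpart_le G p p"
proof -
  obtain Z S where p: "p = (Z, S)" by fastforce
  have "\<exists>g\<in>carrier G. \<forall>x\<in>B. b x = g \<otimes> a x"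
    if "(C, b) \<in> S" "(B, a) \<in> S" "B \<subseteq> C" for B C a b
  proof -
    have "partition_on ({1..n} - Z) (fst ` S)"
      using assms by (simp add: p partial_G_partitions_def)
    moreover have "B \<in> fst ` S" "C \<in> fst ` S"
      using that by (blast intro: fst_memI)+
    ultimately have "B = C"
      using part_block_sub that(3) by blast
    then have "a = b"
      using gpart_label_unique assms that p by blast
    then show ?thesis
      using prop_refl[of B a] gpart_label_closed assms that p by blast
  qed
  moreover have "\<exists>\<B> \<subseteq> fst ` S. C = \<Union>\<B>" if "(C, b) \<in> S" for C b
    using that by (intro exI[of _ "{C}"]) force
  ultimately show ?thesis
    unfolding p by (intro gpart_leI subset_refl)
qed

lemma gpart_le_trans:
  assumes "p \<in> partial_G_partitions n G" "gpart_le G p q" "gpart_le G q r"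
  shows "gpart_le G p r"
proof -
  obtain Z S Z' S' Z'' S'' where p: "p = (Z, S)" "q = (Z', S')" "r = (Z'', S'')"
    by (metis surj_pair)
  have un1: "\<exists>\<B> \<subseteq> fst ` S. C = \<Union>\<B>" if "C \<in> fst ` S'" for C
    using gpart_leD(2)[OF assms(2)[unfolded p] that] .
  have un2: "\<exists>\<B> \<subseteq> fst ` S'. C = \<Union>\<B>" if "C \<in> fst ` S''" for C
    using gpart_leD(2)[OF assms(3)[unfolded p] that] .
  have part: "partition_on ({1..n} - Z) (fst ` S)"
    using assms(1) by (simp add: p partial_G_partitions_def)
  have un3: "\<exists>\<B> \<subseteq> fst ` S. D = \<Union>\<B>" if D: "D \<in> fst ` S''" for D
  proof -
    obtain \<B> where B: "\<B> \<subseteq> fst ` S'" "D = \<Union>\<B>" using un2[OF D] by (elim exE conjE)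
    have "\<forall>C\<in>\<B>. \<exists>\<A>. \<A> \<subseteq> fst ` S \<and> C = \<Union>\<A>" using un1 subsetD[OF B(1)] by simp
    then obtain F where F: "\<forall>C\<in>\<B>. F C \<subseteq> fst ` S \<and> C = \<Union>(F C)" by metis
    have "\<Union>(F ` \<B>) \<subseteq> fst ` S" using F by (intro UN_least) simp
    moreover have "(\<Union>C\<in>\<B>. \<Union>(F C)) = (\<Union>C\<in>\<B>. C)" using F by (intro SUP_cong) simp_all
    moreover have "\<Union>(\<Union>(F ` \<B>)) = (\<Union>C\<in>\<B>. \<Union>(F C))" by blast
    ultimately have "\<Union>(F ` \<B>) \<subseteq> fst ` S" "D = \<Union>(\<Union>(F ` \<B>))" using B(2) by simp_all
    then show ?thesis by blast
  qed
  have lab: "\<exists>g\<in>carrier G. \<forall>x\<in>B. c x = g \<otimes> a x"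
    if h: "(D, c) \<in> S''" "(B, a) \<in> S" "B \<subseteq> D" for B D a c
  proof -
    have BS: "B \<in> fst ` S" using h(2) by force
    then have "B \<noteq> {}" using part by (auto dest: partition_onD3)
    then obtain x where x: "x \<in> B" by blast
    obtain \<B> where "\<B> \<subseteq> fst ` S'" "D = \<Union>\<B>" using un2[of D] h(1) by force
    then obtain C b where C: "(C, b) \<in> S'" "x \<in> C" "C \<subseteq> D"
      using x h(3) by (force simp: image_def)
    obtain \<A> where A: "\<A> \<subseteq> fst ` S" "C = \<Union>\<A>" using un1[of C] C(1) by force
    then obtain A where "A \<in> \<A>" "x \<in> A" using C(2) by blast
    then have "A = B" using part_block_eq[OF part(1) _ BS _ x] A(1) by blast
    then have "B \<subseteq> C" using A \<open>A \<in> \<A>\<close> by blast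
    then have "\<exists>g\<in>carrier G. \<forall>x\<in>B. b x = g \<otimes> a x"
      using gpart_leD(3)[OF assms(2)[unfolded p] C(1) h(2)] by simp
    moreover have "\<exists>g\<in>carrier G. \<forall>x\<in>C. c x = g \<otimes> b x"
      using gpart_leD(3)[OF assms(3)[unfolded p] h(1) C(1,3)] .
    ultimately show ?thesis
      using prop_trans[of B a b c] gpart_label_closed assms(1) h(2) p(1) \<open>B \<subseteq> C\<close> by blast
  qed
  have "Z \<subseteq> Z''"
    using gpart_leD(1)[OF assms(2)[unfolded p]] gpart_leD(1)[OF assms(3)[unfolded p]] by simp
  then show ?thesis
    unfolding p using un3[OF fst_memI] lab by (rule gpart_leI)
qed

lemma equiv_gpart_rel: "equiv (partial_G_partitions n G) (gpart_rel n G)"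
proof (rule equivI)
  show "gpart_rel n G \<subseteq> partial_G_partitions n G \<times> partial_G_partitions n G"
    by (auto simp: gpart_rel_def)
  show "refl_on (partial_G_partitions n G) (gpart_rel n G)"
  proof (rule refl_onI)
    fix p assume "p \<in> partial_G_partitions n G"
    moreover obtain Z S where p: "p = (Z, S)" by fastforce
    ultimately have pp: "(Z, S) \<in> partial_G_partitions n G" by simp
    have "\<exists>g\<in>carrier G. \<forall>x\<in>B. b x = g \<otimes> a x" if "(B, a) \<in> S" "(B, b) \<in> S" for B a b
      using prop_refl[of B a] gpart_label_closed[OF pp that(1)] gpart_label_unique[OF pp that]
      by blast
    then show "(p, p) \<in> gpart_rel n G"
      unfolding p by (intro gpart_relI pp refl)
  qed
  show "sym (gpart_rel n G)"
  proof (rule symI)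
    fix p q assume pq: "(p, q) \<in> gpart_rel n G"
    obtain Z S Z' S' where p: "p = (Z, S)" "q = (Z', S')" by (metis surj_pair)
    have P: "(Z, S) \<in> partial_G_partitions n G" "(Z', S') \<in> partial_G_partitions n G"
      "Z = Z'" "fst ` S = fst ` S'"
      and L: "\<And>B a b. (B, a) \<in> S \<Longrightarrow> (B, b) \<in> S' \<Longrightarrow> \<exists>g\<in>carrier G. \<forall>x\<in>B. b x = g \<otimes> a x"
      using gpart_relD[OF pq[unfolded p]] by simp_all
    have "\<exists>g\<in>carrier G. \<forall>x\<in>B. a x = g \<otimes> b x" if "(B, a) \<in> S" "(B, b) \<in> S'" for B a b
      using prop_sym[of B a b] gpart_label_closed[OF P(1) that(1)] L[OF that] by blast
    then show "(q, p) \<in> gpart_rel n G"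
      unfolding p by (intro gpart_relI P P(3,4)[symmetric])
  qed
  show "trans (gpart_rel n G)"
  proof (rule transI)
    fix p q r assume pq: "(p, q) \<in> gpart_rel n G" and qr: "(q, r) \<in> gpart_rel n G"
    obtain Z S Z' S' Z'' S'' where p: "p = (Z, S)" "q = (Z', S')" "r = (Z'', S'')"
      by (metis surj_pair)
    have P: "(Z, S) \<in> partial_G_partitions n G" "(Z'', S'') \<in> partial_G_partitions n G"
      "Z = Z'" "Z' = Z''" "fst ` S = fst ` S'" "fst ` S' = fst ` S''"
      and L: "\<And>B a b. (B, a) \<in> S \<Longrightarrow> (B, b) \<in> S' \<Longrightarrow> \<exists>g\<in>carrier G. \<forall>x\<in>B. b x = g \<otimes> a x"
      and L': "\<And>B a b. (B, a) \<in> S' \<Longrightarrow> (B, b) \<in> S'' \<Longrightarrow> \<exists>g\<in>carrier G. \<forall>x\<in>B. b x = g \<otimes> a x"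
      using gpart_relD[OF pq[unfolded p]] gpart_relD[OF qr[unfolded p]] by simp_all
    have "\<exists>g\<in>carrier G. \<forall>x\<in>B. c x = g \<otimes> a x" if h: "(B, a) \<in> S" "(B, c) \<in> S''" for B a c
    proof -
      have "B \<in> fst ` S'" using h(1) P(5) by force
      then obtain b where "(B, b) \<in> S'" by force
      then show ?thesis
        using prop_trans[of B a b c] gpart_label_closed[OF P(1) h(1)] L[of B a b] L'[of B b c] h
        by blast
    qed
    then show "(p, r) \<in> gpart_rel n G"
      unfolding p by (intro gpart_relI P(1,2) trans[OF P(3,4)] trans[OF P(5,6)])
  qed
qed

lemma gpart_rel_imp_le:
  assumes "(p, q) \<in> gpart_rel n G"
  shows "gpart_le G p q"
proof -
  obtain Z S Z' S' where p: "p = (Z, S)" "q = (Z', S')" by (metis surj_pair)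
  have P: "(Z, S) \<in> partial_G_partitions n G" "Z = Z'" "fst ` S = fst ` S'"
    and L: "\<And>B a b. (B, a) \<in> S \<Longrightarrow> (B, b) \<in> S' \<Longrightarrow> \<exists>g\<in>carrier G. \<forall>x\<in>B. b x = g \<otimes> a x"
    using gpart_relD[OF assms[unfolded p]] by simp_all
  have part: "partition_on ({1..n} - Z) (fst ` S)"
    using P by (simp add: partial_G_partitions_def)
  have "\<exists>g\<in>carrier G. \<forall>x\<in>B. b x = g \<otimes> a x"
    if h: "(C, b) \<in> S'" "(B, a) \<in> S" "B \<subseteq> C" for B C a b
  proof -
    have "B \<in> fst ` S" "C \<in> fst ` S" 
      using fst_memI[OF h(2)] fst_memI[OF h(1)] P(3) by simp_all
    then have "B = C"
      using part_block_sub[OF part _ _ h(3)] by blast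
    then show ?thesis using L h by blast
  qed
  moreover have "\<exists>\<B> \<subseteq> fst ` S. C = \<Union>\<B>" if "(C, b) \<in> S'" for C b
    using fst_memI[OF that] P(3) by (intro exI[of _ "{C}"]) simp
  ultimately show ?thesis
    unfolding p P(2) by (intro gpart_leI subset_refl)
qed

lemma gpart_le_respects:
  assumes "(p, p') \<in> gpart_rel n G" "(q, q') \<in> gpart_rel n G"
  shows "gpart_le G p q \<longleftrightarrow> gpart_le G p' q'"
proof -
  have "(p', p) \<in> gpart_rel n G" "(q', q) \<in> gpart_rel n G"
    using assms equiv_gpart_rel by (meson equivE symE)+
  moreover have "p \<in> partial_G_partitions n G" "p' \<in> partial_G_partitions n G"
    using assms by (auto simp: gpart_rel_def)
  ultimately show ?thesis
    using assms gpart_rel_imp_le gpart_le_trans by meson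
qed

lemma gpart_le_antisym:
  assumes P: "p \<in> partial_G_partitions n G" "q \<in> partial_G_partitions n G"
    and le: "gpart_le G p q" "gpart_le G q p"
  shows "(p, q) \<in> gpart_rel n G"
proof -
  obtain Z S Z' S' where p: "p = (Z, S)" "q = (Z', S')" by (metis surj_pair)
  have Z: "Z = Z'" using le by (auto simp: p gpart_le_def)
  have part: "partition_on ({1..n} - Z) (fst ` S)" "partition_on ({1..n} - Z) (fst ` S')"
    using P by (simp_all add: p Z partial_G_partitions_def)
  have sub: "\<X> \<subseteq> \<Y>"
    if X: "partition_on A \<X>" and Y: "partition_on A \<Y>"
      and XY: "\<forall>C\<in>\<X>. \<exists>\<B>\<subseteq>\<Y>. C = \<Union>\<B>" and YX: "\<forall>C\<in>\<Y>. \<exists>\<B>\<subseteq>\<X>. C = \<Union>\<B>"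
    for A :: "nat set" and \<X> \<Y>
  proof
    fix C assume C: "C \<in> \<X>"
    then obtain x where x: "x \<in> C" using X partition_onD3 by fastforce
    obtain \<B> where "\<B> \<subseteq> \<Y>" "C = \<Union>\<B>" using bspec[OF XY C] by (elim exE conjE)
    then obtain D where D: "D \<in> \<Y>" "x \<in> D" "D \<subseteq> C" using x by blast
    obtain \<A> where A: "\<A> \<subseteq> \<X>" "D = \<Union>\<A>" using bspec[OF YX D(1)] by (elim exE conjE)
    then obtain E where E: "E \<in> \<A>" "x \<in> E" using D by blast
    then have "E = C" using part_block_eq[OF X _ C _ x] A(1) by blast
    then have "D = C" using A E D by blast
    then show "C \<in> \<Y>" using D by simp
  qed
  have un: "\<forall>C\<in>fst ` S'. \<exists>\<B>\<subseteq>fst ` S. C = \<Union>\<B>" "\<forall>C\<in>fst ` S. \<exists>\<B>\<subseteq>fst ` S'. C = \<Union>\<B>"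
    using gpart_leD(2)[OF le(1)[unfolded p]] gpart_leD(2)[OF le(2)[unfolded p]] by simp_all
  have "fst ` S = fst ` S'"
    by (rule subset_antisym[OF sub[OF part un(2,1)] sub[OF part(2,1) un]])
  moreover have "\<exists>g\<in>carrier G. \<forall>x\<in>B. b x = g \<otimes> a x" if "(B, a) \<in> S" "(B, b) \<in> S'" for B a b
    using gpart_leD(3)[OF le(1)[unfolded p] that(2,1) subset_refl] .
  ultimately show ?thesis
    using P Z unfolding p by (intro gpart_relI)
qed

lemma dowling_le_iff:
  assumes "X \<in> carrier (dowling_lattice n G)" "Y \<in> carrier (dowling_lattice n G)" "p \<in> X" "q \<in> Y"
  shows "le (dowling_lattice n G) X Y \<longleftrightarrow> gpart_le G p q"
proof
  assume "le (dowling_lattice n G) X Y"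
  then obtain p' q' where "p' \<in> X" "q' \<in> Y" "gpart_le G p' q'"
    by (auto simp: dowling_lattice_def)
  moreover have "(p', p) \<in> gpart_rel n G" "(q', q) \<in> gpart_rel n G"
    using assms \<open>p' \<in> X\<close> \<open>q' \<in> Y\<close>
      quotient_eq_iff[OF equiv_gpart_rel, of X n X p' p] quotient_eq_iff[OF equiv_gpart_rel, of Y n Y q' q]
    by (simp_all add: dowling_lattice_def)
  ultimately show "gpart_le G p q" using gpart_le_respects by blast
qed (use assms in \<open>auto simp: dowling_lattice_def\<close>)

lemma partial_order_dowling_lattice: "partial_order (dowling_lattice n G)"
proof -
  let ?D = "dowling_lattice n G"
  have rep: "\<exists>p. p \<in> X \<and> p \<in> partial_G_partitions n G" if "X \<in> carrier ?D" for X
  proof -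
    have X: "X \<in> partial_G_partitions n G // gpart_rel n G"
      using that by (simp add: dowling_lattice_def)
    then have "X \<noteq> {}" "X \<subseteq> partial_G_partitions n G"
      using in_quotient_imp_non_empty[OF equiv_gpart_rel X]
        in_quotient_imp_subset[OF equiv_gpart_rel X] by auto
    then show ?thesis by blast
  qed
  have re: "le ?D X X" if "X \<in> carrier ?D" for X
    using rep[OF that] gpart_le_refl dowling_le_iff[OF that that] by blast
  have as: "X = Y" if h: "le ?D X Y" "le ?D Y X" "X \<in> carrier ?D" "Y \<in> carrier ?D" for X Y
  proof -
    obtain p q where pq: "p \<in> X" "p \<in> partial_G_partitions n G" "q \<in> Y" "q \<in> partial_G_partitions n G"
      using rep h by meson
    then have "(p, q) \<in> gpart_rel n G"
      using gpart_le_antisym[of p n q] dowling_le_iff[OF h(3,4) pq(1,3)]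
        dowling_le_iff[OF h(4,3) pq(3,1)] h(1,2) by simp
    then show ?thesis
      using quotient_eqI[OF equiv_gpart_rel] h(3,4) pq by (auto simp: dowling_lattice_def)
  qed
  have tr: "le ?D X W"
    if h: "le ?D X Y" "le ?D Y W" "X \<in> carrier ?D" "Y \<in> carrier ?D" "W \<in> carrier ?D" for X Y W
  proof -
    obtain p q r where pqr: "p \<in> X" "p \<in> partial_G_partitions n G" "q \<in> Y" "r \<in> W"
      using rep h by meson
    then show ?thesis
      using gpart_le_trans[of p n q r] dowling_le_iff[OF h(3,4) pqr(1,3)]
        dowling_le_iff[OF h(4,5) pqr(3,4)] dowling_le_iff[OF h(3,5) pqr(1,4)] h(1,2) by simp
  qed
  have eq: "eq ?D = (=)" by (simp add: dowling_lattice_def)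
  show ?thesis
    by unfold_locales (use re as tr in \<open>auto simp: eq\<close>)
qed

end

end

theory Submission
  imports Defs
begin

text \<open>Write \<open>\<C>(z)\<close> for the set of members of \<open>\<C>\<close> containing \<open>z\<close>. By hypothesis \<open>M(\<C>)\<close> is simple, and by
  Hall's condition three points are dependent iff together they meet only two members of \<open>\<C>\<close>. So
  every line with at least three points is \<open>{z. \<C>(z) \<subseteq> P}\<close> for some \<open>P\<close> with two elements. Two such lines
  can only meet in a point with \<open>\<C>(z)\<close> a singleton, and \<open>P\<close> contains just two singletons, each the
  \<open>\<C>(z)\<close> of at most one point. Hence no line meets three further lines, all with at least three points,
  in three different points. For \<open>n \<ge> 3\<close> the Dowling lattice contains such a configuration, found by
  taking all labels trivial: the four lines of \<open>M(K\<^sub>4)\<close>. For \<open>n = 2\<close> the lattice is a single line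
  with \<open>|G| + 2 \<ge> 3\<close> points, so \<open>U = {z. \<C>(z) \<subseteq> P}\<close>, and \<open>E({x}) = U\<close> whenever \<open>|\<C>(x)| = 2\<close>.

  Heights are transported along the isomorphism by the number of nonzero blocks, which strictly
  decreases along the order of the Dowling lattice.\<close>

section \<open>Points and lines of a simple transversal matroid\<close>

lemma matroid_rank_le:
  assumes "finite X" "\<And>I. I \<subseteq> X \<Longrightarrow> indep I \<Longrightarrow> card I \<le> r" "indep {}"
  shows "matroid_rank indep X \<le> r"
  unfolding matroid_rank_def using assms by (subst Max_le_iff) auto

lemma card_le_matroid_rank:
  assumes "finite X" "I \<subseteq> X" "indep I"
  shows "card I \<le> matroid_rank indep X"
  unfolding matroid_rank_def using assms by (intro Max_ge) auto

lemma matroid_rank_attained: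
  assumes "finite X" "indep {}"
  obtains I where "I \<subseteq> X" "indep I" "card I = matroid_rank indep X"
proof -
  have "matroid_rank indep X \<in> card ` {I. I \<subseteq> X \<and> indep I}"
    unfolding matroid_rank_def using assms by (intro Max_in) auto
  then show thesis using that by auto
qed

lemma matroid_rank_mono:
  assumes "finite Y" "X \<subseteq> Y" "indep {}"
  shows "matroid_rank indep X \<le> matroid_rank indep Y"
  using assms by (intro matroid_rank_le) (auto intro: card_le_matroid_rank finite_subset)

lemma matroid_flatI:
  assumes "F \<subseteq> U" "\<And>w. w \<in> U \<Longrightarrow> w \<notin> F \<Longrightarrow> matroid_rank indep F < matroid_rank indep (insert w F)"
  shows "F \<in> matroid_flats U indep"
proof -
  have "w \<in> F" if "w \<in> U" "matroid_rank indep (insert w F) = matroid_rank indep F" for w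
    using assms(2)[of w] that by force
  then show ?thesis
    using assms(1) by (auto simp: matroid_flats_def matroid_closure_def insert_absorb)
qed

lemma matroid_flatD:
  assumes "F \<in> matroid_flats U indep"
  shows "F \<subseteq> U" "z \<in> U \<Longrightarrow> matroid_rank indep (insert z F) = matroid_rank indep F \<Longrightarrow> z \<in> F"
  using assms by (auto simp: matroid_flats_def matroid_closure_def)

section \<open>Independent sets of at most three points\<close>

locale simple_covering =
  fixes U :: "'a set" and \<C> :: "'a set set"
  assumes finite_U: "finite U" and covering: "covering U \<C>"
    and simple: "\<lbrakk>u \<in> U; v \<in> U; u \<noteq> v; cov_meeting \<C> {u} = cov_meeting \<C> {v}\<rbrakk>
      \<Longrightarrow> card (cov_meeting \<C> {u}) \<noteq> 1"
begin

abbreviation cov_at :: "'a \<Rightarrow> 'a set set" where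
  "cov_at x \<equiv> cov_meeting \<C> {x}"

abbreviation indep :: "'a set \<Rightarrow> bool" where
  "indep \<equiv> transversal_indep U \<C>"

abbreviation flats :: "'a set set" where
  "flats \<equiv> matroid_flats U indep"

lemma finite_\<C>: "finite \<C>"
  using covering finite_U by (meson covering_def finite_Pow_iff finite_subset)

lemma mem_cov_at_iff: "C \<in> cov_at x \<longleftrightarrow> C \<in> \<C> \<and> x \<in> C"
  by (auto simp: cov_meeting_def)

lemma finite_cov_at: "finite (cov_at x)"
  using finite_\<C> by (simp add: cov_meeting_def)

lemma cov_at_nonempty: "x \<in> U \<Longrightarrow> cov_at x \<noteq> {}"
  using covering by (fastforce simp: covering_def cov_meeting_def)

lemma indep_iff:
  "indep I \<longleftrightarrow> I \<subseteq> U \<and> (\<exists>\<phi>. inj_on \<phi> I \<and> (\<forall>e\<in>I. \<phi> e \<in> cov_at e))"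
  by (simp add: transversal_indep_def mem_cov_at_iff)

lemma indep_empty: "indep {}"
  by (simp add: indep_iff)

lemma indep_singleton:
  assumes "x \<in> U" shows "indep {x}"
proof -
  obtain A where "A \<in> cov_at x" using cov_at_nonempty[OF assms] by blast
  then show ?thesis unfolding indep_iff using assms by (intro conjI exI[of _ "\<lambda>_. A"]) auto
qed

text \<open>If every member of one nonempty family equals every member of another, both families are
  the same singleton, which \<open>simple\<close> forbids.\<close>

lemma pair_transversal:
  assumes "x \<in> U" "y \<in> U" "x \<noteq> y"
  obtains A B where "A \<in> cov_at x" "B \<in> cov_at y" "A \<noteq> B"
proof -
  obtain A where A: "A \<in> cov_at x" using assms cov_at_nonempty by (meson ex_in_conv)
  obtain B where B: "B \<in> cov_at y" using assms cov_at_nonempty by (meson ex_in_conv)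
  have "\<exists>A\<in>cov_at x. \<exists>B\<in>cov_at y. A \<noteq> B"
  proof (rule ccontr)
    assume "\<not> ?thesis"
    then have eq: "C = D" if "C \<in> cov_at x" "D \<in> cov_at y" for C D using that by blast
    have "cov_at x = {B}" using A eq[OF _ B] by (intro equalityI subsetI) auto
    moreover have "cov_at y = {B}" using B eq[OF A] by (intro equalityI subsetI) auto
    ultimately have "cov_at x = {B}" "cov_at y = {B}" by simp_all
    then show False using simple[OF assms] by simp
  qed
  then show thesis using that by blast
qed

lemma indep_pairI:
  assumes "x \<in> U" "y \<in> U" "x \<noteq> y" "A \<in> cov_at x" "B \<in> cov_at y" "A \<noteq> B"
  shows "indep {x, y}"
  unfolding indep_iff using assms by (intro conjI exI[of _ "(\<lambda>_. B)(x := A)"]) auto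

lemma indep_pair:
  assumes "x \<in> U" "y \<in> U" "x \<noteq> y"
  shows "indep {x, y}"
proof -
  obtain A B where "A \<in> cov_at x" "B \<in> cov_at y" "A \<noteq> B"
    by (rule pair_transversal[OF assms])
  then show ?thesis by (rule indep_pairI[OF assms])
qed

lemma card_cov_at_pair:
  assumes "x \<in> U" "y \<in> U" "x \<noteq> y"
  shows "2 \<le> card (cov_at x \<union> cov_at y)"
proof -
  obtain A B where AB: "A \<in> cov_at x" "B \<in> cov_at y" "A \<noteq> B"
    by (rule pair_transversal[OF assms])
  then have "card {A, B} \<le> card (cov_at x \<union> cov_at y)"
    by (intro card_mono) (auto simp: finite_cov_at)
  then show ?thesis using AB by simp
qed

lemma indep_tripleI:
  assumes "x \<in> U" "y \<in> U" "z \<in> U" "x \<noteq> y" "x \<noteq> z" "y \<noteq> z"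
    "A \<in> cov_at x" "B \<in> cov_at y" "D \<in> cov_at z" "A \<noteq> B" "A \<noteq> D" "B \<noteq> D"
  shows "indep {x, y, z}"
  unfolding indep_iff using assms by (intro conjI exI[of _ "(\<lambda>_. D)(x := A, y := B)"]) auto

text \<open>Hall's condition for three elements; it suffices to ask it of the whole triple, because
  pairs satisfy it by simplicity.\<close>

lemma indep_triple:
  assumes U: "x \<in> U" "y \<in> U" "z \<in> U" and ne: "x \<noteq> y" "x \<noteq> z" "y \<noteq> z"
    and card: "3 \<le> card (cov_at x \<union> cov_at y \<union> cov_at z)"
  shows "indep {x, y, z}"
proof -
  note I = indep_tripleI[OF U ne]
  obtain A B where A: "A \<in> cov_at x" and B: "B \<in> cov_at y" and AB: "A \<noteq> B"
    by (rule pair_transversal[OF U(1,2) ne(1)])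
  have "\<not> cov_at x \<union> cov_at y \<union> cov_at z \<subseteq> {A, B}"
    using card card_mono[of "{A, B}" "cov_at x \<union> cov_at y \<union> cov_at z"] AB by auto
  then obtain D where D: "D \<in> cov_at x \<union> cov_at y \<union> cov_at z" "D \<noteq> A" "D \<noteq> B" by blast
  obtain E1 E2 where xz: "E1 \<in> cov_at x" "E2 \<in> cov_at z" "E1 \<noteq> E2"
    by (rule pair_transversal[OF U(1,3) ne(2)])
  obtain F1 F2 where yz: "F1 \<in> cov_at y" "F2 \<in> cov_at z" "F1 \<noteq> F2"
    by (rule pair_transversal[OF U(2,3) ne(3)])
  show ?thesis
  proof (rule ccontr)
    assume "\<not> ?thesis"
    then have no: "\<And>A B D. A \<in> cov_at x \<Longrightarrow> B \<in> cov_at y \<Longrightarrow> D \<in> cov_at z \<Longrightarrow>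
       A = B \<or> A = D \<or> B = D" using I by blast
    from D(1) consider "D \<in> cov_at z" | "D \<in> cov_at x" | "D \<in> cov_at y" by blast
    then show False
    proof cases
      case 1
      then show False using no[OF A B] AB D by blast
    next
      case 2
      \<comment> \<open>With \<open>y\<close> sent to \<open>B\<close>, the point \<open>x\<close>
        may be sent to \<open>A\<close> or to \<open>D\<close>; both choices must block
        \<open>F2\<close>, so \<open>F2\<close> is \<open>B\<close>. Then \<open>z\<close> can take
        \<open>B\<close> and \<open>y\<close> can take \<open>F1\<close>, and one of
        \<open>A\<close>, \<open>D\<close> differs from \<open>F1\<close> and is free for
        \<open>x\<close>.\<close>
      have "F2 = B" using no[OF A B yz(2)] no[OF 2 B yz(2)] AB D by blast
      then show False using no[OF 2 yz(1,2)] no[OF A yz(1,2)] yz(3) AB D by blast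
    next
      case 3
      have "E2 = A" using no[OF A B xz(2)] no[OF A 3 xz(2)] AB D by blast
      then show False using no[OF xz(1) 3 xz(2)] no[OF xz(1) B xz(2)] xz(3) AB D by blast
    qed
  qed
qed

lemma card_indep_le:
  assumes "indep I" "\<And>e. e \<in> I \<Longrightarrow> cov_at e \<subseteq> P" "finite P"
  shows "card I \<le> card P"
proof -
  obtain \<phi> where "inj_on \<phi> I" "\<And>e. e \<in> I \<Longrightarrow> \<phi> e \<in> cov_at e"
    using assms(1) by (auto simp: indep_iff)
  then show ?thesis using assms(2,3) by (intro card_inj_on_le[of \<phi>]) auto
qed

lemma indep_finite: "indep I \<Longrightarrow> finite I"
  using finite_U finite_subset by (auto simp: indep_iff)

section \<open>Flats spanned by at most two points\<close>

lemma empty_flat: "{} \<in> flats"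
proof (rule matroid_flatI)
  fix w assume w: "w \<in> U"
  have "matroid_rank indep {} \<le> 0" by (rule matroid_rank_le) (auto simp: indep_empty)
  moreover have "card {w} \<le> matroid_rank indep {w}"
    by (rule card_le_matroid_rank) (auto simp: w indep_singleton)
  ultimately show "matroid_rank indep {} < matroid_rank indep {w}" by simp
qed simp

lemma U_flat: "U \<in> flats"
  by (rule matroid_flatI) auto

lemma singleton_flat:
  assumes "x \<in> U" shows "{x} \<in> flats"
proof (rule matroid_flatI)
  fix w assume w: "w \<in> U" "w \<notin> {x}"
  have "matroid_rank indep {x} \<le> 1"
    using card_mono[of "{x}"] by (intro matroid_rank_le) (auto simp: indep_empty)
  moreover have "card {w, x} \<le> matroid_rank indep {w, x}"
    by (rule card_le_matroid_rank) (use w assms in \<open>auto intro: indep_pair\<close>)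
  ultimately show "matroid_rank indep {x} < matroid_rank indep {w, x}" using w by simp
qed (use assms in simp)

text \<open>This replaces the closure of a pair. If \<open>cov_at x\<close> and
  \<open>cov_at y\<close> have more than two members together, every third point completes an
  independent triple, so the pair is a flat. Otherwise they have exactly two, and the points
  confined to these form a flat of rank at most two that lies in every flat through \<open>x\<close>
  and \<open>y\<close>.\<close>

lemma pair_closure:
  assumes x: "x \<in> U" and y: "y \<in> U" and ne: "x \<noteq> y"
    and F: "F \<in> flats" "x \<in> F" "y \<in> F"
  obtains "{x, y} \<in> flats"
  | P where "card P = 2" "{z \<in> U. cov_at z \<subseteq> P} \<in> flats" "{z \<in> U. cov_at z \<subseteq> P} \<subseteq> F"
      "x \<in> {z \<in> U. cov_at z \<subseteq> P}" "y \<in> {z \<in> U. cov_at z \<subseteq> P}"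
proof -
  define P where "P = cov_at x \<union> cov_at y"
  have finP: "finite P" by (simp add: P_def finite_cov_at)
  define K where "K = {z \<in> U. cov_at z \<subseteq> P}"
  have xyK: "x \<in> K" "y \<in> K" using x y by (auto simp: K_def P_def)
  have triple: "3 \<le> matroid_rank indep (insert w X)"
    if "w \<in> U" "x \<in> X" "y \<in> X" "X \<subseteq> U" "w \<noteq> x" "w \<noteq> y" "3 \<le> card (P \<union> cov_at w)" for w X
  proof -
    have "indep {x, y, w}" using that x y ne by (intro indep_triple) (auto simp: P_def)
    then have "card {x, y, w} \<le> matroid_rank indep (insert w X)"
      using that finite_U by (intro card_le_matroid_rank) (auto intro: finite_subset)
    then show ?thesis using that ne by simp
  qed
  show thesis
  proof (cases "card P = 2")
    case True
    have "K \<in> flats"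
    proof (rule matroid_flatI)
      fix w assume w: "w \<in> U" "w \<notin> K"
      have "matroid_rank indep K \<le> 2"
        unfolding True[symmetric]
        by (rule matroid_rank_le)
           (use finite_U finP indep_empty card_indep_le[of _ P] in \<open>auto simp: K_def subset_iff\<close>)
      moreover have "3 \<le> matroid_rank indep (insert w K)"
      proof (rule triple[OF w(1) xyK])
        have "P \<subset> P \<union> cov_at w" using w by (auto simp: K_def)
        then show "3 \<le> card (P \<union> cov_at w)"
          using psubset_card_mono[of "P \<union> cov_at w" P] finP finite_cov_at True by simp
      qed (use w xyK in \<open>auto simp: K_def\<close>)
      ultimately show "matroid_rank indep K < matroid_rank indep (insert w K)" by simp
    qed (auto simp: K_def)
    \<comment> \<open>Since \<open>F\<close> is a flat, it is enough that adding a point of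
      \<open>K\<close> does not raise its rank.\<close>
    moreover have "K \<subseteq> F"
    proof
      fix z assume z: "z \<in> K"
      have FU: "F \<subseteq> U" and zU: "z \<in> U" using matroid_flatD[OF F(1)] z by (auto simp: K_def)
      then have finF: "finite F" using finite_U finite_subset by blast
      obtain J where J: "J \<subseteq> insert z F" "indep J" "card J = matroid_rank indep (insert z F)"
        using matroid_rank_attained[of "insert z F" indep] finF indep_empty by auto
      obtain \<phi> where \<phi>: "inj_on \<phi> J" "\<And>e. e \<in> J \<Longrightarrow> \<phi> e \<in> cov_at e"
        using J(2) by (auto simp: indep_iff)
      obtain A B where AB: "A \<in> cov_at x" "B \<in> cov_at y" "A \<noteq> B"
        by (rule pair_transversal[OF x y ne])
      txt \<open>In a partial transversal \<open>J\<close> of \<open>F \<union> {z}\<close>, trade the at most two elements sent into \<open>P\<close>,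
        \<open>z\<close> among them, for \<open>x\<close> and \<open>y\<close>: this gives one of the same size inside \<open>F\<close>.\<close>
      define J1 where "J1 = {e \<in> J. \<phi> e \<notin> P}"
      have finJ: "finite J" using J indep_finite by simp
      have disj: "x \<notin> J1" "y \<notin> J1" "z \<notin> J1"
        using \<phi>(2) z by (auto simp: J1_def P_def K_def)
      have "indep (J1 \<union> {x, y})"
        unfolding indep_iff
      proof (intro conjI exI[of _ "\<phi>(x := A, y := B)"] ballI)
        show "inj_on (\<phi>(x := A, y := B)) (J1 \<union> {x, y})"
          using \<phi> AB disj ne by (auto simp: inj_on_def J1_def P_def)
      qed (use \<phi> AB disj ne J x y indep_iff in \<open>auto simp: J1_def\<close>)
      then have "card (J1 \<union> {x, y}) \<le> matroid_rank indep F"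
        by (intro card_le_matroid_rank finF) (use J disj F in \<open>auto simp: J1_def\<close>)
      moreover have "card (J1 \<union> {x, y}) = card J1 + 2"
        using disj ne finJ by (subst card_Un_disjoint) (auto simp: J1_def)
      moreover have "card J \<le> card J1 + 2"
      proof -
        have "card (J - J1) \<le> card P"
          by (rule card_inj_on_le[of \<phi>]) (use \<phi>(1) finP in \<open>auto simp: J1_def inj_on_def\<close>)
        moreover have "card J = card J1 + card (J - J1)"
          using finJ by (metis J1_def card_mono card_Diff_subset finite_subset le_add_diff_inverse mem_Collect_eq subsetI)
        ultimately show ?thesis using True by simp
      qed
      moreover have "matroid_rank indep F \<le> matroid_rank indep (insert z F)"
        by (rule matroid_rank_mono) (auto simp: finF indep_empty)
      ultimately have "matroid_rank indep (insert z F) = matroid_rank indep F" using J(3) by simp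
      then show "z \<in> F" using matroid_flatD(2)[OF F(1) zU] by simp
    qed
    ultimately show thesis using that(2)[of P] True xyK by (simp add: K_def)
  next
    case False
    then have P3: "3 \<le> card P" using card_cov_at_pair[OF x y ne] by (simp add: P_def)
    have "{x, y} \<in> flats"
    proof (rule matroid_flatI)
      fix w assume w: "w \<in> U" "w \<notin> {x, y}"
      have "matroid_rank indep {x, y} \<le> card {x, y}"
        using card_mono[of "{x, y}"] by (intro matroid_rank_le) (auto simp: indep_empty)
      moreover have "3 \<le> matroid_rank indep (insert w {x, y})"
        by (rule triple) (use w x y P3 card_mono[of "P \<union> cov_at w" P] finP finite_cov_at in auto)
      ultimately show "matroid_rank indep {x, y} < matroid_rank indep (insert w {x, y})"
        using ne by simp
    qed (use x y in auto)
    then show thesis by (rule that(1))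
  qed
qed

text \<open>\<open>P\<close> contains just two singletons, and by simplicity each of them is \<open>cov_at e\<close> for at most
  one \<open>e\<close>.\<close>

lemma full_of_three:
  assumes "card P = 2" "card {x, y, z} = 3"
    and "\<And>e. e \<in> {x, y, z} \<Longrightarrow> e \<in> U \<and> cov_at e \<subseteq> P"
  shows "\<exists>e\<in>{x, y, z}. cov_at e = P"
proof (rule ccontr)
  assume no: "\<not> ?thesis"
  have finP: "finite P" using assms(1) card.infinite by fastforce
  have c1: "card (cov_at e) = 1" if "e \<in> {x, y, z}" for e
  proof -
    have "cov_at e \<subset> P" using no assms(3)[OF that] that by blast
    then have "card (cov_at e) < 2" using psubset_card_mono[OF finP] assms(1) by metis
    moreover have "card (cov_at e) \<noteq> 0"
      using cov_at_nonempty assms(3)[OF that] finite_cov_at by simp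
    ultimately show ?thesis by linarith
  qed
  have "inj_on cov_at {x, y, z}"
    using simple c1 assms(3) by (meson inj_onI)
  then have "card (cov_at ` {x, y, z}) = 3" using assms(2) card_image by metis
  moreover have "cov_at ` {x, y, z} \<subseteq> (\<lambda>A. {A}) ` P"
  proof
    fix Q assume "Q \<in> cov_at ` {x, y, z}"
    then obtain e where e: "e \<in> {x, y, z}" "Q = cov_at e" by blast
    then obtain A where "cov_at e = {A}" using c1 card_1_singletonE by metis
    then show "Q \<in> (\<lambda>A. {A}) ` P" using assms(3)[OF e(1)] e(2) by simp
  qed
  then have "card (cov_at ` {x, y, z}) \<le> card P"
    using finP by (meson card_image_le card_mono finite_imageI le_trans)
  ultimately show False using assms(1) by simp
qed

end

section \<open>Points and lines recognised by a strictly increasing height\<close>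

locale graded_covering = simple_covering +
  fixes \<rho> :: "'a set \<Rightarrow> nat"
  assumes strict: "\<lbrakk>F \<in> flats; F' \<in> flats; F \<subset> F'\<rbrakk> \<Longrightarrow> \<rho> F < \<rho> F'"
begin

lemma height_singleton_pos: "x \<in> U \<Longrightarrow> 0 < \<rho> {x}"
  using strict[OF empty_flat singleton_flat] by fastforce

text \<open>The height need not be the rank: strict growth bounds the length of chains of flats. A
  chain from {} through {x} to a larger \<open>F\<close> would force height at least two.\<close>

lemma height_one_flat:
  assumes "F \<in> flats" "F \<noteq> {}" "\<rho> F \<le> 1"
  obtains x where "x \<in> U" "F = {x}"
proof -
  obtain x where x: "x \<in> F" using assms by blast
  then have xU: "x \<in> U" using matroid_flatD(1)[OF assms(1)] by blast
  have "\<not> {x} \<subset> F"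
    using strict[OF singleton_flat[OF xU] assms(1)] height_singleton_pos[OF xU] assms(3) by auto
  then show thesis using that[OF xU] x by blast
qed

text \<open>A chain from {} through {x} and a flat \<open>K\<close> to a larger \<open>F\<close>
  would force height at least three. So the flat given by \<open>pair_closure\<close> is
  \<open>F\<close> itself, and the third point rules out that it is just a pair.\<close>

lemma height_two_flat:
  assumes F: "F \<in> flats" "\<rho> F \<le> 2" and xyz: "card {x, y, z} = 3" "{x, y, z} \<subseteq> F"
  obtains P where "card P = 2" "F = {z \<in> U. cov_at z \<subseteq> P}"
proof -
  have FU: "F \<subseteq> U" by (rule matroid_flatD[OF F(1)])
  have ne: "x \<noteq> y" "z \<noteq> x" "z \<noteq> y" using xyz by (auto simp: card_insert_if split: if_splits)
  have min: "K = F" if K: "K \<in> flats" "x \<in> K" "y \<in> K" "K \<subseteq> F" for K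
  proof -
    have "{x} \<subset> K" using K ne by blast
    then have "\<rho> {x} < \<rho> K" using strict singleton_flat K FU by blast
    moreover have "0 < \<rho> {x}" using height_singleton_pos K FU by blast
    ultimately have "\<not> \<rho> K < \<rho> F" using F(2) by linarith
    then show ?thesis using strict[OF K(1) F(1)] K(4) by blast
  qed
  show thesis
  proof (rule pair_closure[of x y F])
    assume "{x, y} \<in> flats"
    then have "{x, y} = F" using min xyz by blast
    then show thesis using xyz ne by blast
  next
    fix P assume P: "card P = 2" "{z \<in> U. cov_at z \<subseteq> P} \<in> flats" "{z \<in> U. cov_at z \<subseteq> P} \<subseteq> F"
      "x \<in> {z \<in> U. cov_at z \<subseteq> P}" "y \<in> {z \<in> U. cov_at z \<subseteq> P}"
    then show thesis using that[of P] min[OF P(2,4,5,3)] by blast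
  qed (use F xyz FU ne in auto)
qed

text \<open>If \<open>L1 = {z. cov_at z \<subseteq> P}\<close>, then a point \<open>z\<close> of \<open>L1\<close> on a second such line has \<open>cov_at z \<noteq> P\<close>,
  while one of any three points of \<open>L1\<close> has \<open>cov_at z = P\<close>.\<close>

lemma no_line_with_three_crossings:
  assumes fl: "L1 \<in> flats" "L2 \<in> flats" "L3 \<in> flats" "L4 \<in> flats"
    and h: "\<rho> L1 \<le> 2" "\<rho> L2 \<le> 2" "\<rho> L3 \<le> 2" "\<rho> L4 \<le> 2"
    and ne: "L1 \<noteq> L2" "L1 \<noteq> L3" "L1 \<noteq> L4"
    and card: "card {a, b, c} = 3" "card {a, d, e} = 3" "card {b, d, f} = 3" "card {c, e, f} = 3"
    and sub: "{a, b, c} \<subseteq> L1" "{a, d, e} \<subseteq> L2" "{b, d, f} \<subseteq> L3" "{c, e, f} \<subseteq> L4"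
  shows False
proof -
  obtain P1 where P1: "card P1 = 2" "L1 = {z \<in> U. cov_at z \<subseteq> P1}"
    by (rule height_two_flat[OF fl(1) h(1) card(1) sub(1)])
  have cross: "cov_at x \<noteq> P1" 
    if L: "L \<in> flats" "\<rho> L \<le> 2" "L1 \<noteq> L" "card {x, y, z} = 3" "{x, y, z} \<subseteq> L" for L x y z
  proof -
    obtain P where P: "card P = 2" "L = {z \<in> U. cov_at z \<subseteq> P}"
      by (rule height_two_flat[OF L(1,2,4,5)])
    \<comment> \<open>Both sets have two members, so inclusion would make them equal, and the two
      lines with them.\<close>
    have "\<not> P1 \<subseteq> P" using card_subset_eq[of P P1] P P1 L(3) card.infinite[of P] by fastforce
    then show ?thesis using P L(5) by blast
  qed
  have "\<exists>e\<in>{a, b, c}. cov_at e = P1"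
    by (rule full_of_three[OF P1(1) card(1)]) (use sub(1) P1(2) in blast)
  then show False
    using cross[OF fl(2) h(2) ne(1) card(2) sub(2)] cross[OF fl(3) h(3) ne(2) card(3) sub(3)]
      cross[OF fl(4) h(4) ne(3) card(4) sub(4)] by blast
qed

lemma card_cov_Es_of_line:
  assumes "\<rho> U \<le> 2" "3 \<le> card U"
  shows "card (cov_Es U \<C>) = 1"
proof -
  obtain T where T: "T \<subseteq> U" "card T = 3" using obtain_subset_with_card_n[OF assms(2)] by metis
  then obtain x y z where xyz: "T = {x, y, z}" by (meson card_3_iff)
  obtain P where P: "card P = 2" "U = {z \<in> U. cov_at z \<subseteq> P}"
    by (rule height_two_flat[OF U_flat assms(1), of x y z]) (use T xyz in simp_all)
  have finP: "finite P" using P(1) card.infinite by fastforce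
  \<comment> \<open>This point is what makes \<open>cov_Es U \<C>\<close> nonempty.\<close>
  have "\<exists>e\<in>{x, y, z}. cov_at e = P"
    by (rule full_of_three[OF P(1)]) (use T xyz P(2) in auto)
  then obtain e where e: "e \<in> U" "cov_at e = P" using T xyz by blast
  have "cov_E U \<C> v = U" if "v \<in> U" "card (cov_at v) = 2" for v
  proof -
    have "cov_at v = P" using that P finP by (intro card_subset_eq) auto
    then show ?thesis using P(2) by (auto simp: cov_E_def)
  qed
  then have "cov_Es U \<C> = {U}" using e P(1) by (auto simp: cov_Es_def)
  then show ?thesis by simp
qed

end

section \<open>Heights in the Dowling lattice\<close>

context group
begin

section \<open>The number of nonzero blocks as a measure of height\<close>

lemma partial_G_partitionD:
  assumes "(Z, S) \<in> partial_G_partitions n G"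
  shows "Z \<subseteq> {1..n}" "partition_on ({1..n} - Z) (fst ` S)" "inj_on fst S"
    "(B, a) \<in> S \<Longrightarrow> a \<in> B \<rightarrow>\<^sub>E carrier G"
  using assms by (auto simp: partial_G_partitions_def)

lemma partial_G_partitionI:
  assumes "Z \<subseteq> {1..n}" "partition_on ({1..n} - Z) (fst ` S)" "inj_on fst S"
    "\<And>B a. (B, a) \<in> S \<Longrightarrow> a \<in> B \<rightarrow>\<^sub>E carrier G"
  shows "(Z, S) \<in> partial_G_partitions n G"
  using assms by (fastforce simp: partial_G_partitions_def)

lemma finite_blocks: "(Z, S) \<in> partial_G_partitions n G \<Longrightarrow> finite (fst ` S)"
  by (rule finite_elements[OF _ partial_G_partitionD(2)]) auto

lemma card_blocks: "(Z, S) \<in> partial_G_partitions n G \<Longrightarrow> card (fst ` S) = card S"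
  by (simp add: card_image partial_G_partitionD(3))

text \<open>Guarantees that the truncated subtraction in \<open>dowling_height\<close> loses
  nothing, so that fewer blocks do mean greater height.\<close>

lemma card_blocks_le:
  assumes "(Z, S) \<in> partial_G_partitions n G"
  shows "card S \<le> n"
proof -
  note part = partial_G_partitionD(2)[OF assms]
  have "\<exists>x. x \<in> B" if "B \<in> fst ` S" for B
    using partition_onD3[OF part] that by (metis ex_in_conv)
  then obtain m where m: "\<And>B. B \<in> fst ` S \<Longrightarrow> m B \<in> B" by metis
  have "card (fst ` S) \<le> card {1..n}"
  proof (rule card_inj_on_le)
    show "inj_on m (fst ` S)"
      by (rule inj_onI) (metis m part_block_eq[OF part])
    show "m ` fst ` S \<subseteq> {1..n}"
      using m partition_onD1[OF part] by blast
  qed simp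
  then show ?thesis using card_blocks[OF assms] by simp
qed

text \<open>Every block of the larger partition contains a block of the smaller one.\<close>

lemma gpart_le_card:
  assumes P: "(Z, S) \<in> partial_G_partitions n G" "(Z', S') \<in> partial_G_partitions n G"
    and le: "gpart_le G (Z, S) (Z', S')"
  shows "card S' \<le> card S" "card S' = card S \<Longrightarrow> ((Z, S), (Z', S')) \<in> gpart_rel n G"
proof -
  note part = partial_G_partitionD(2)[OF P(1)] and part' = partial_G_partitionD(2)[OF P(2)]
  have "\<exists>B. B \<in> fst ` S \<and> B \<subseteq> C" if C: "C \<in> fst ` S'" for C
  proof -
    obtain \<B> where B: "\<B> \<subseteq> fst ` S" "C = \<Union>\<B>" using gpart_leD(2)[OF le C] by blast
    have "C \<noteq> {}" using partition_onD3[OF part'] C by blast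
    then obtain B0 where "B0 \<in> \<B>" using B(2) by blast
    then show ?thesis using B by blast
  qed
  then obtain c where c: "\<And>C. C \<in> fst ` S' \<Longrightarrow> c C \<in> fst ` S" "\<And>C. C \<in> fst ` S' \<Longrightarrow> c C \<subseteq> C"
    by metis
  have ne: "\<exists>x. x \<in> B" if "B \<in> fst ` S" for B
    using partition_onD3[OF part] that by (metis ex_in_conv)
  have inj: "inj_on c (fst ` S')"
  proof (rule inj_onI)
    fix C D assume CD: "C \<in> fst ` S'" "D \<in> fst ` S'" "c C = c D"
    obtain x where x: "x \<in> c C" using ne[OF c(1)[OF CD(1)]] by blast
    have "x \<in> C" using c(2)[OF CD(1)] x by (rule subsetD)
    moreover have "x \<in> D" using c(2)[OF CD(2)] x unfolding CD(3) by (rule subsetD)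
    ultimately show "C = D" by (rule part_block_eq[OF part' CD(1,2)])
  qed
  have im: "c ` fst ` S' \<subseteq> fst ` S" using c(1) by blast
  show "card S' \<le> card S"
    using card_inj_on_le[OF inj im finite_blocks[OF P(1)]] unfolding card_blocks[OF P(1)] card_blocks[OF P(2)] .
  assume eq: "card S' = card S"
  \<comment> \<open>With equally many blocks \<open>c\<close> is onto. A point of \<open>C\<close>
    lies in some block \<open>c D\<close>, hence in \<open>D\<close>; disjointness gives
    \<open>C = D\<close>, so the point lies in \<open>c C\<close>.\<close>
  have surj: "c ` fst ` S' = fst ` S"
    by (rule card_subset_eq[OF finite_blocks[OF P(1)] im])
       (simp only: card_image[OF inj] eq card_blocks[OF P(1)] card_blocks[OF P(2)])
  have "c C = C" if C: "C \<in> fst ` S'" for C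
  proof
    show "C \<subseteq> c C"
    proof
      fix x assume x: "x \<in> C"
      obtain \<B> where \<B>: "\<B> \<subseteq> fst ` S" "C = \<Union>\<B>" using gpart_leD(2)[OF le C] by blast
      then obtain B where B: "B \<in> \<B>" "x \<in> B" using x by blast
      have "B \<in> c ` fst ` S'" unfolding surj by (rule subsetD[OF \<B>(1) B(1)])
      then obtain D where D: "D \<in> fst ` S'" "B = c D" by (rule imageE)
      have "x \<in> D" using c(2)[OF D(1)] B(2) unfolding D(2) by (rule subsetD)
      then have "C = D" by (rule part_block_eq[OF part' C D(1) x])
      then show "x \<in> c C" using B D by simp
    qed
  qed (rule c(2)[OF C])
  then have "c ` fst ` S' = (\<lambda>C. C) ` fst ` S'" by (rule image_cong[OF refl])
  then have fst: "fst ` S = fst ` S'" unfolding surj by simp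
  have "{1..n} - Z = {1..n} - Z'"
    using partition_onD1[OF part] partition_onD1[OF part'] fst by simp
  then have "Z = Z'" using partial_G_partitionD(1)[OF P(1)] partial_G_partitionD(1)[OF P(2)] by blast
  then show "((Z, S), (Z', S')) \<in> gpart_rel n G"
    using gpart_leD(3)[OF le _ _ subset_refl] by (intro gpart_relI P fst)
qed

text \<open>The usual rank function of the Dowling lattice, read off from an arbitrary
  representative; by \<open>dowling_height_class\<close> the choice does not matter.\<close>

definition dowling_height :: "nat \<Rightarrow> 'a gpart set \<Rightarrow> nat" where
  "dowling_height n X = n - card (snd (SOME p. p \<in> X))"

lemma dowling_class:
  assumes "X \<in> carrier (dowling_lattice n G)"
  obtains Z S where "(Z, S) \<in> partial_G_partitions n G" "X = gpart_rel n G `` {(Z, S)}"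
  using assms by (auto simp: dowling_lattice_def elim!: quotientE)

lemma class_in_dowling:
  "p \<in> partial_G_partitions n G \<Longrightarrow> gpart_rel n G `` {p} \<in> carrier (dowling_lattice n G)"
  by (auto simp: dowling_lattice_def quotientI)

lemma class_self:
  "p \<in> partial_G_partitions n G \<Longrightarrow> p \<in> gpart_rel n G `` {p}"
  using equiv_class_self[OF equiv_gpart_rel] .

lemma class_le_iff:
  assumes "p \<in> partial_G_partitions n G" "q \<in> partial_G_partitions n G"
  shows "le (dowling_lattice n G) (gpart_rel n G `` {p}) (gpart_rel n G `` {q}) \<longleftrightarrow> gpart_le G p q"
  by (intro dowling_le_iff class_in_dowling class_self assms)

lemma dowling_height_class:
  assumes "(Z, S) \<in> partial_G_partitions n G"
  shows "dowling_height n (gpart_rel n G `` {(Z, S)}) = n - card S"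
proof -
  define p where "p = (SOME p. p \<in> gpart_rel n G `` {(Z, S)})"
  have "p \<in> gpart_rel n G `` {(Z, S)}"
    unfolding p_def by (rule someI[of _ "(Z, S)"]) (rule class_self[OF assms])
  then obtain Z' S' where p: "p = (Z', S')" and rel: "((Z, S), (Z', S')) \<in> gpart_rel n G"
    by (metis Image_singleton_iff surj_pair)
  have "card S' = card S"
    using gpart_relD(1,2,4)[OF rel] card_blocks by metis
  then show ?thesis
    using p p_def by (simp add: dowling_height_def del: Image_singleton_iff)
qed

lemma dowling_height_strict:
  assumes "X \<in> carrier (dowling_lattice n G)" "Y \<in> carrier (dowling_lattice n G)"
    "le (dowling_lattice n G) X Y" "X \<noteq> Y"
  shows "dowling_height n X < dowling_height n Y"
proof -
  obtain Z S where X: "(Z, S) \<in> partial_G_partitions n G" "X = gpart_rel n G `` {(Z, S)}"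
    by (rule dowling_class[OF assms(1)])
  obtain Z' S' where Y: "(Z', S') \<in> partial_G_partitions n G" "Y = gpart_rel n G `` {(Z', S')}"
    by (rule dowling_class[OF assms(2)])
  have le: "gpart_le G (Z, S) (Z', S')" using assms(3) class_le_iff X Y by simp
  have "card S' \<noteq> card S"
    using gpart_le_card(2)[OF X(1) Y(1) le] assms(4) X Y equiv_class_eq[OF equiv_gpart_rel] by metis
  then have "card S' < card S" using gpart_le_card(1)[OF X(1) Y(1) le] by simp
  then show ?thesis
    using card_blocks_le[OF X(1)] by (simp add: X Y dowling_height_class)
qed

section \<open>Partitions with trivial labels, given by colourings\<close>

text \<open>The element of the Dowling lattice whose zero block and nonzero blocks are the fibres of \<open>c\<close>
  over \<open>0\<close> and over the other values, all labels being trivial.\<close>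

definition trivial_gpart :: "nat \<Rightarrow> (nat \<Rightarrow> nat) \<Rightarrow> 'a gpart" where
  "trivial_gpart n c = ({i \<in> {1..n}. c i = 0},
     (\<lambda>v. ({i \<in> {1..n}. c i = v}, restrict (\<lambda>_. \<one>) {i \<in> {1..n}. c i = v})) ` (c ` {1..n} - {0}))"

lemma fst_snd_trivial_gpart:
  "fst ` snd (trivial_gpart n c) = (\<lambda>v. {i \<in> {1..n}. c i = v}) ` (c ` {1..n} - {0})"
  by (simp add: trivial_gpart_def image_image)

lemma trivial_gpart_closed: "trivial_gpart n c \<in> partial_G_partitions n G"
proof -
  have Z: "fst (trivial_gpart n c) = {i \<in> {1..n}. c i = 0}"
    by (simp add: trivial_gpart_def)
  have "(fst (trivial_gpart n c), snd (trivial_gpart n c)) \<in> partial_G_partitions n G"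
  proof (rule partial_G_partitionI)
    show "partition_on ({1..n} - fst (trivial_gpart n c)) (fst ` snd (trivial_gpart n c))"
      unfolding fst_snd_trivial_gpart Z by (auto simp: partition_on_def disjoint_def)
    show "inj_on fst (snd (trivial_gpart n c))"
      by (rule inj_onI) (auto simp: trivial_gpart_def)
    show "a \<in> B \<rightarrow>\<^sub>E carrier G" if "(B, a) \<in> snd (trivial_gpart n c)" for B a
      using that unfolding trivial_gpart_def by auto
    show "fst (trivial_gpart n c) \<subseteq> {1..n}" unfolding Z by (rule Collect_restrict)
  qed
  then show ?thesis by simp
qed

lemma card_snd_trivial_gpart: "card (snd (trivial_gpart n c)) = card (c ` {1..n} - {0})"
proof -
  have "inj_on (\<lambda>v. {i \<in> {1..n}. c i = v}) (c ` {1..n} - {0})"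
  proof (rule inj_onI)
    fix v w assume v: "v \<in> c ` {1..n} - {0}" and eq: "{i \<in> {1..n}. c i = v} = {i \<in> {1..n}. c i = w}"
    obtain i where "i \<in> {1..n}" "v = c i" using v by blast
    then have "i \<in> {i \<in> {1..n}. c i = w}" unfolding eq[symmetric] by simp
    then show "v = w" using \<open>v = c i\<close> by simp
  qed
  then have "card (fst ` snd (trivial_gpart n c)) = card (c ` {1..n} - {0})"
    unfolding fst_snd_trivial_gpart by (rule card_image)
  moreover have "(fst (trivial_gpart n c), snd (trivial_gpart n c)) \<in> partial_G_partitions n G"
    using trivial_gpart_closed by simp
  ultimately show ?thesis using card_blocks by metis
qed

text \<open>With all labels trivial, the factor \<open>\<one>\<close> always serves and only the
  blocks count. The order becomes coarsening of colourings, with colour 0 kept fixed.\<close>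

lemma trivial_gpart_le_iff:
  "gpart_le G (trivial_gpart n c) (trivial_gpart n d) \<longleftrightarrow>
     (\<forall>i\<in>{1..n}. c i = 0 \<longrightarrow> d i = 0) \<and> (\<forall>i\<in>{1..n}. \<forall>j\<in>{1..n}. c i = c j \<longrightarrow> d i = d j)"
  (is "?l \<longleftrightarrow> ?r")
proof
  assume ?l
  then have le: "gpart_le G (fst (trivial_gpart n c), snd (trivial_gpart n c))
      (fst (trivial_gpart n d), snd (trivial_gpart n d))" by simp
  have "fst (trivial_gpart n c) \<subseteq> fst (trivial_gpart n d)" by (rule gpart_leD(1)[OF le])
  then have zero: "d i = 0" if "i \<in> {1..n}" "c i = 0" for i
    using that unfolding trivial_gpart_def by auto
  have eq: "d j = d i" if i: "i \<in> {1..n}" "j \<in> {1..n}" "c i = c j" "d i \<noteq> 0" for i j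
  proof -
    have "{l \<in> {1..n}. d l = d i} \<in> fst ` snd (trivial_gpart n d)"
      unfolding fst_snd_trivial_gpart using i by (intro imageI) auto
    then obtain \<B> where \<B>: "\<B> \<subseteq> fst ` snd (trivial_gpart n c)" "{l \<in> {1..n}. d l = d i} = \<Union>\<B>"
      using gpart_leD(2)[OF le] by meson
    have "i \<in> \<Union>\<B>" unfolding \<B>(2)[symmetric] using i by simp
    then obtain B where B: "B \<in> \<B>" "i \<in> B" by (rule UnionE)
    have "B \<in> fst ` snd (trivial_gpart n c)" by (rule subsetD[OF \<B>(1) B(1)])
    then obtain v where "B = {i \<in> {1..n}. c i = v}"
      unfolding fst_snd_trivial_gpart by (rule imageE)
    then have "j \<in> B" using B(2) i by simp
    then have "j \<in> \<Union>\<B>" using B(1) by (rule UnionI[rotated])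
    then show ?thesis unfolding \<B>(2)[symmetric] by simp
  qed
  \<comment> \<open>Colour 0 has no nonzero block, so \<open>eq\<close> needs \<open>d i\<close> to
    be nonzero; exchanging \<open>i\<close> and \<open>j\<close> leaves only the case where both
    colours are 0.\<close>
  have "d i = d j" if ij: "i \<in> {1..n}" "j \<in> {1..n}" "c i = c j" for i j
    using eq[OF ij] eq[OF ij(2,1) ij(3)[symmetric]] by metis
  with zero show ?r by (intro conjI ballI impI)
next
  assume r: ?r
  then have r0: "d i = 0" if "i \<in> {1..n}" "c i = 0" for i using that by blast
  have r1: "d i = d j" if "i \<in> {1..n}" "j \<in> {1..n}" "c i = c j" for i j using r that by blast
  have "gpart_le G (fst (trivial_gpart n c), snd (trivial_gpart n c))
      (fst (trivial_gpart n d), snd (trivial_gpart n d))"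
  proof (rule gpart_leI)
    show "fst (trivial_gpart n c) \<subseteq> fst (trivial_gpart n d)"
      using r0 unfolding trivial_gpart_def by auto
  next
    fix C b assume "(C, b) \<in> snd (trivial_gpart n d)"
    then have "C \<in> fst ` snd (trivial_gpart n d)" by (rule fst_memI)
    then obtain v where v: "v \<noteq> 0" "C = {i \<in> {1..n}. d i = v}"
      unfolding fst_snd_trivial_gpart by blast
    \<comment> \<open>The fibres of \<open>c\<close> that meet \<open>C\<close>: by
      \<open>r0\<close> none of them is the zero block, and by \<open>r1\<close> none leaves
      \<open>C\<close>.\<close>
    define \<B> where "\<B> = (\<lambda>v. {i \<in> {1..n}. c i = v}) ` c ` C"
    have "c ` C \<subseteq> c ` {1..n} - {0}"
    proof (intro image_subsetI DiffI)
      show "c i \<notin> {0}" if "i \<in> C" for i using r0[of i] that v by auto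
    qed (simp add: v(2))
    then have "\<B> \<subseteq> fst ` snd (trivial_gpart n c)"
      unfolding fst_snd_trivial_gpart \<B>_def by (rule image_mono)
    moreover have "C = \<Union>\<B>"
    proof
      show "\<Union>\<B> \<subseteq> C"
      proof
        fix j assume "j \<in> \<Union>\<B>"
        then obtain B where B: "B \<in> \<B>" "j \<in> B" by (rule UnionE)
        obtain w where w: "w \<in> c ` C" "B = {i \<in> {1..n}. c i = w}"
          using B(1) unfolding \<B>_def by (rule imageE)
        obtain i where i: "w = c i" "i \<in> C" using w(1) by (rule imageE)
        have "d j = d i"
          by (rule r1) (use B(2) i w(2) v(2) in simp_all)
        then show "j \<in> C" using B(2) i(2) w(2) v(2) by simp
      qed
    qed (auto simp: \<B>_def v(2))
    ultimately show "\<exists>\<B> \<subseteq> fst ` snd (trivial_gpart n c). C = \<Union>\<B>" by (intro exI conjI)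
  next
    fix B C a b assume *: "(C, b) \<in> snd (trivial_gpart n d)" "(B, a) \<in> snd (trivial_gpart n c)" "B \<subseteq> C"
    have "b x = \<one>" if "x \<in> C" for x using *(1) that unfolding trivial_gpart_def by auto
    moreover have "a x = \<one>" if "x \<in> B" for x using *(2) that unfolding trivial_gpart_def by auto
    ultimately have "\<forall>x\<in>B. b x = \<one> \<otimes> a x" using *(3) by auto
    then show "\<exists>g\<in>carrier G. \<forall>x\<in>B. b x = g \<otimes> a x" by (rule bexI) simp
  qed
  then show ?l by simp
qed

definition trivial_class :: "nat \<Rightarrow> (nat \<Rightarrow> nat) \<Rightarrow> 'a gpart set" where
  "trivial_class n c = gpart_rel n G `` {trivial_gpart n c}"

lemma trivial_class_closed: "trivial_class n c \<in> carrier (dowling_lattice n G)"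
  unfolding trivial_class_def by (rule class_in_dowling[OF trivial_gpart_closed])

lemma trivial_class_le_iff:
  "le (dowling_lattice n G) (trivial_class n c) (trivial_class n d) \<longleftrightarrow>
     (\<forall>i\<in>{1..n}. c i = 0 \<longrightarrow> d i = 0) \<and> (\<forall>i\<in>{1..n}. \<forall>j\<in>{1..n}. c i = c j \<longrightarrow> d i = d j)"
  unfolding trivial_class_def
  by (simp add: class_le_iff trivial_gpart_closed trivial_gpart_le_iff)

lemma dowling_height_trivial_class:
  "dowling_height n (trivial_class n c) = n - card (c ` {1..n} - {0})"
  using dowling_height_class[of "fst (trivial_gpart n c)" "snd (trivial_gpart n c)" n]
  by (simp add: trivial_class_def trivial_gpart_closed card_snd_trivial_gpart)

lemma class_eqI:
  assumes "(p, q) \<in> gpart_rel n G"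
  shows "gpart_rel n G `` {p} = gpart_rel n G `` {q}"
  using equiv_class_eq[OF equiv_gpart_rel assms] .

lemma class_eq_iff:
  assumes "p \<in> partial_G_partitions n G" "q \<in> partial_G_partitions n G"
  shows "gpart_rel n G `` {p} = gpart_rel n G `` {q} \<longleftrightarrow> (p, q) \<in> gpart_rel n G"
  using eq_equiv_class_iff[OF equiv_gpart_rel assms] .

section \<open>The points of the Dowling line\<close>

text \<open>Representatives of the points of the Dowling line: the two zero blocks of size one, and the
  nonzero block \<open>{1, 2}\<close> with its labelings normalised to take the value \<open>\<one>\<close> at \<open>1\<close>.\<close>

definition line_zero_point :: "nat \<Rightarrow> 'a gpart" where
  "line_zero_point i = ({i}, {({3 - i}, \<lambda>x\<in>{3 - i}. \<one>)})"

definition line_label_point :: "'a \<Rightarrow> 'a gpart" where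
  "line_label_point g = ({}, {({1, 2}, \<lambda>x\<in>{1, 2}. if x = 1 then \<one> else g)})"

lemma atLeast_1_atMost_2: "{1..2::nat} = {1, 2}"
  by auto

lemma single_block_closed:
  "Z \<subseteq> {1, 2} \<Longrightarrow> B = {1, 2} - Z \<Longrightarrow> B \<noteq> {} \<Longrightarrow> a \<in> B \<rightarrow>\<^sub>E carrier G \<Longrightarrow>
    (Z, {(B, a)}) \<in> partial_G_partitions 2 G"
  by (auto simp: partial_G_partitions_def partition_on_def atLeast_1_atMost_2)

lemma single_block_rel:
  assumes "(Z, {(B, a)}) \<in> partial_G_partitions 2 G" "(Z, {(B, b)}) \<in> partial_G_partitions 2 G"
    "g \<in> carrier G" "\<And>x. x \<in> B \<Longrightarrow> b x = g \<otimes> a x"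
  shows "((Z, {(B, a)}), (Z, {(B, b)})) \<in> gpart_rel 2 G"
  by (rule gpart_relI) (use assms in auto)

text \<open>Height one means a single nonzero block. All labelings of a one-element block are
  equivalent, which gives two classes; on {1, 2} the element \<open>inv (a 1) \<otimes> a 2\<close>
  is a complete invariant under left multiplication, which gives one class for each group
  element.\<close>

lemma card_dowling_line_points:
  assumes fin: "finite (carrier G)"
  shows "card {X \<in> carrier (dowling_lattice 2 G). dowling_height 2 X = 1} = card (carrier G) + 2"
proof -
  define T where "T = line_zero_point ` {1, 2} \<union> line_label_point ` carrier G"
  have zcl: "line_zero_point i \<in> partial_G_partitions 2 G" if "i \<in> {1, 2}" for i
    unfolding line_zero_point_def using that by (intro single_block_closed) auto
  have lcl: "line_label_point g \<in> partial_G_partitions 2 G" if "g \<in> carrier G" for g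
    unfolding line_label_point_def using that by (intro single_block_closed) auto
  have Tcl: "T \<subseteq> partial_G_partitions 2 G" using zcl lcl by (auto simp: T_def)
  have Tcard: "card (snd t) = 1" if "t \<in> T" for t
    using that by (auto simp: T_def line_zero_point_def line_label_point_def)
  have L: "\<exists>g\<in>carrier G. t = line_label_point g" if "t \<in> T" "fst t = {}" for t
    using that by (auto simp: T_def line_zero_point_def)
  have inj: "t = t'" if t: "t \<in> T" "t' \<in> T" and rel: "(t, t') \<in> gpart_rel 2 G" for t t'
  proof -
    have fst: "fst t = fst t'" using rel by (auto simp: gpart_rel_def)
    show ?thesis
    proof (cases "fst t = {}")
      case True
      then obtain g h where gh: "t = line_label_point g" "t' = line_label_point h"
        "g \<in> carrier G" "h \<in> carrier G"
        using L[OF t(1) True] L[OF t(2)] True fst by auto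
      obtain k where k: "k \<in> carrier G"
        "\<forall>x\<in>{1, 2}. (\<lambda>x\<in>{1, 2::nat}. if x = 1 then \<one> else h) x = k \<otimes> (\<lambda>x\<in>{1, 2}. if x = 1 then \<one> else g) x"
        using gpart_relD(5)[OF rel[unfolded gh line_label_point_def], OF singletonI singletonI] by blast
      then have "k = \<one>" "h = k \<otimes> g" by simp_all
      then show ?thesis using gh by simp
    next
      case False
      then show ?thesis using t fst by (auto simp: T_def line_zero_point_def line_label_point_def)
    qed
  qed
  have "bij_betw (\<lambda>t. gpart_rel 2 G `` {t}) T {X \<in> carrier (dowling_lattice 2 G). dowling_height 2 X = 1}"
  proof (rule bij_betwI')
    fix t t' assume "t \<in> T" "t' \<in> T"
    then show "gpart_rel 2 G `` {t} = gpart_rel 2 G `` {t'} \<longleftrightarrow> t = t'"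
      using inj class_eq_iff Tcl by blast
  next
    fix t assume t: "t \<in> T"
    then have "t \<in> partial_G_partitions 2 G" using Tcl by blast
    then show "gpart_rel 2 G `` {t} \<in> {X \<in> carrier (dowling_lattice 2 G). dowling_height 2 X = 1}"
      using dowling_height_class[of "fst t" "snd t" 2] Tcard[OF t] class_in_dowling[of t 2] by simp
  next
    fix X assume "X \<in> {X \<in> carrier (dowling_lattice 2 G). dowling_height 2 X = 1}"
    then have X: "X \<in> carrier (dowling_lattice 2 G)" "dowling_height 2 X = 1" by auto
    obtain Z S where ZS: "(Z, S) \<in> partial_G_partitions 2 G" "X = gpart_rel 2 G `` {(Z, S)}"
      by (rule dowling_class[OF X(1)])
    have "card S = 1" using X(2) dowling_height_class[OF ZS(1)] ZS(2) by simp
    then obtain B a where S: "S = {(B, a)}" by (metis card_1_singletonE surj_pair)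
    have a: "a \<in> B \<rightarrow>\<^sub>E carrier G" and Z: "Z \<subseteq> {1, 2}" and B: "B = {1, 2} - Z" "B \<noteq> {}"
      using partial_G_partitionD[OF ZS(1)] by (auto simp: S partition_on_def atLeast_1_atMost_2)
    show "\<exists>t\<in>T. X = gpart_rel 2 G `` {t}"
    proof (cases "Z = {}")
      case True
      then have B12: "B = {1, 2}" using B by simp
      then have a12: "a 1 \<in> carrier G" "a 2 \<in> carrier G" using a by auto
      define t where "t = line_label_point (inv (a 1) \<otimes> a 2)"
      have "((Z, S), t) \<in> gpart_rel 2 G"
        unfolding S t_def line_label_point_def True B12
      proof (rule single_block_rel[where g = "inv (a 1)"])
        show "({}, {({1, 2}, \<lambda>x\<in>{1, 2}. if x = 1 then \<one> else inv (a 1) \<otimes> a 2)}) \<in> partial_G_partitions 2 G"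
          using a12 by (intro lcl[unfolded line_label_point_def]) auto
        show "({}, {({1, 2}, a)}) \<in> partial_G_partitions 2 G" using ZS(1) S True B12 by simp
        show "(\<lambda>x\<in>{1, 2}. if x = 1 then \<one> else inv (a 1) \<otimes> a 2) x = inv (a 1) \<otimes> a x" if "x \<in> {1, 2}" for x
          using that a12 by auto
      qed (use a12 in simp)
      moreover have "t \<in> T" using a12 by (auto simp: T_def t_def)
      ultimately show ?thesis using ZS class_eqI by blast
    next
      case False
      \<comment> \<open>For \<open>i\<close> in {1, 2}, the other element is
        \<open>3 - i\<close>.\<close>
      then have "Z = {1} \<and> B = {3 - 1} \<or> Z = {2} \<and> B = {3 - 2}" using Z B by auto
      then obtain i :: nat where i: "i \<in> {1, 2}" "Z = {i}" "B = {3 - i}" by blast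
      have ai: "a (3 - i) \<in> carrier G" using a i by auto
      have "((Z, S), line_zero_point i) \<in> gpart_rel 2 G"
        unfolding S line_zero_point_def i
      proof (rule single_block_rel[where g = "inv (a (3 - i))"])
        show "({i}, {({3 - i}, a)}) \<in> partial_G_partitions 2 G" using ZS(1) S i by simp
        show "({i}, {({3 - i}, \<lambda>x\<in>{3 - i}. \<one>)}) \<in> partial_G_partitions 2 G"
          by (rule zcl[OF i(1), unfolded line_zero_point_def])
        show "(\<lambda>x\<in>{3 - i}. \<one>) x = inv (a (3 - i)) \<otimes> a x" if "x \<in> {3 - i}" for x
          using that ai by simp
      qed (use ai in simp)
      moreover have "line_zero_point i \<in> T" using i by (auto simp: T_def)
      ultimately show ?thesis using ZS class_eqI by blast
    qed
  qed
  then have "card {X \<in> carrier (dowling_lattice 2 G). dowling_height 2 X = 1} = card T"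
    by (simp add: bij_betw_same_card)
  also have "\<dots> = card (line_zero_point ` {1, 2}) + card (line_label_point ` carrier G)"
    unfolding T_def by (rule card_Un_disjoint)
      (use fin in \<open>auto simp: line_zero_point_def line_label_point_def\<close>)
  also have "card (line_zero_point ` {1, 2}) = 2"
    by (subst card_image) (auto simp: inj_on_def line_zero_point_def)
  also have "card (line_label_point ` carrier G) = card (carrier G)"
  proof (rule card_image, rule inj_onI)
    fix g h assume "line_label_point g = line_label_point h"
    then have "(\<lambda>x\<in>{1, 2::nat}. if x = 1 then \<one> else g) 2 = (\<lambda>x\<in>{1, 2::nat}. if x = 1 then \<one> else h) 2"
      by (simp add: line_label_point_def)
    then show "g = h" by simp
  qed
  finally show ?thesis by simp
qed

end

section \<open>Coverings whose lattice of flats is a Dowling lattice\<close>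

locale covering_dowling_iso = simple_covering U \<C> + group G
  for U :: "'a set" and \<C> and G :: "('g, 'b) monoid_scheme" (structure) +
  fixes n :: nat and f :: "'a set \<Rightarrow> 'g gpart set"
  assumes bij: "bij_betw f flats (carrier (dowling_lattice n G))"
    and emb: "\<lbrakk>F \<in> flats; F' \<in> flats\<rbrakk> \<Longrightarrow> le (dowling_lattice n G) (f F) (f F') \<longleftrightarrow> F \<subseteq> F'"
begin

definition flat_height :: "'a set \<Rightarrow> nat" where
  "flat_height F = dowling_height n (f F)"

lemma f_closed: "F \<in> flats \<Longrightarrow> f F \<in> carrier (dowling_lattice n G)"
  using bij by (rule bij_betw_apply)

sublocale graded_covering U \<C> flat_height
proof
  fix F F' assume F: "F \<in> flats" "F' \<in> flats" "F \<subset> F'"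
  have "f F \<noteq> f F'" using bij_betw_imp_inj_on[OF bij] F by (auto dest: inj_onD)
  moreover have "le (dowling_lattice n G) (f F) (f F')" using emb F by blast
  ultimately show "flat_height F < flat_height F'"
    unfolding flat_height_def using dowling_height_strict f_closed F by blast
qed

definition trivial_flat :: "(nat \<Rightarrow> nat) \<Rightarrow> 'a set" where
  "trivial_flat c = inv_into flats f (trivial_class n c)"

lemma trivial_flat: "trivial_flat c \<in> flats" "f (trivial_flat c) = trivial_class n c"
proof -
  have im: "trivial_class n c \<in> f ` flats"
    using bij_betw_imp_surj_on[OF bij] trivial_class_closed by simp
  show "trivial_flat c \<in> flats" unfolding trivial_flat_def by (rule inv_into_into[OF im])
  show "f (trivial_flat c) = trivial_class n c" unfolding trivial_flat_def by (rule f_inv_into_f[OF im])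
qed

lemma trivial_flat_subset_iff:
  "trivial_flat c \<subseteq> trivial_flat d \<longleftrightarrow>
     (\<forall>i\<in>{1..n}. c i = 0 \<longrightarrow> d i = 0) \<and> (\<forall>i\<in>{1..n}. \<forall>j\<in>{1..n}. c i = c j \<longrightarrow> d i = d j)"
  by (simp only: emb[OF trivial_flat(1) trivial_flat(1), symmetric] trivial_flat(2) trivial_class_le_iff)

text \<open>The hypotheses say that \<open>d\<close> factors through \<open>c\<close> and fixes 0,
  which yields both parts of the order criterion. For the updates of \<open>id\<close> below they
  reduce to simplification.\<close>

lemma trivial_flat_mono:
  assumes "d 0 = 0" "\<And>i. d (c i) = d i"
  shows "trivial_flat c \<subseteq> trivial_flat d"
  unfolding trivial_flat_subset_iff by (metis assms)

lemma flat_height_trivial_flat: "flat_height (trivial_flat c) = n - card (c ` {1..n} - {0})"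
  by (simp add: flat_height_def trivial_flat(2) dowling_height_trivial_class)

lemma flat_height_le: "flat_height F \<le> n"
  by (simp add: flat_height_def dowling_height_def)

text \<open>Merging \<open>k\<close> into \<open>j\<close> loses exactly the colour
  \<open>k\<close>, because \<open>j\<close> is either 0 or a colour still in use.\<close>

lemma flat_height_fun_upd:
  assumes "k \<in> {1..n}" "j \<noteq> k" "j \<le> n"
  shows "flat_height (trivial_flat (id(k := j))) = 1"
proof -
  have "(id(k := j)) ` {1..n} - {0} = {1..n} - {k}"
    using assms by (auto simp: image_iff split: if_splits)
  then show ?thesis
    unfolding flat_height_trivial_flat using assms(1) by (simp add: card_Diff_singleton)
qed

lemma trivial_flat_neqI0:
  assumes "i \<in> {1..n}" "c i = 0" "d i \<noteq> 0"
  shows "trivial_flat c \<noteq> trivial_flat d"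
proof -
  have "\<not> trivial_flat c \<subseteq> trivial_flat d"
    unfolding trivial_flat_subset_iff using assms by metis
  then show ?thesis by blast
qed

lemma trivial_flat_neqI:
  assumes "i \<in> {1..n}" "j \<in> {1..n}" "c i = c j" "d i \<noteq> d j"
  shows "trivial_flat c \<noteq> trivial_flat d"
proof -
  have "\<not> trivial_flat c \<subseteq> trivial_flat d"
    unfolding trivial_flat_subset_iff using assms by metis
  then show ?thesis by blast
qed

lemma trivial_flat_point:
  assumes "j < k" "k \<le> n"
  obtains x where "x \<in> U" "trivial_flat (id(k := j)) = {x}"
proof -
  have h: "flat_height (trivial_flat (id(k := j))) = 1"
    using assms by (intro flat_height_fun_upd) auto
  \<comment> \<open>The flat of \<open>id\<close> has height 0. Were it nonempty, {} would have to
    lie strictly below height 0; so {} is this flat, and a flat of height one cannot be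
    empty.\<close>
  have "id ` {1..n} - {0} = {1..n}" by auto
  then have "flat_height (trivial_flat id) = 0" by (simp add: flat_height_trivial_flat)
  moreover have "flat_height {} < flat_height (trivial_flat id)" if "trivial_flat id \<noteq> {}"
    using strict[OF empty_flat trivial_flat(1)] that by blast
  ultimately have "flat_height {} = 0" by fastforce
  then have "trivial_flat (id(k := j)) \<noteq> {}" using h by auto
  then show thesis using height_one_flat[OF trivial_flat(1)] h that by (metis order_refl)
qed

text \<open>A copy of the flats of \<open>M(K\<^sub>4)\<close> on the vertices \<open>0, 1, 2, 3\<close>, with \<open>0\<close> standing for the zero block:
  the six points identify two vertices, the four lines identify three.\<close>

lemma dimension_le_2: "n \<le> 2"
proof (rule ccontr)
  assume "\<not> n \<le> 2"
  then have n: "3 \<le> n" by simp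
  have in0: "1 \<in> {1..n}" "2 \<in> {1..n}" "3 \<in> {1..n}" using n by auto
  obtain a where a: "trivial_flat (id(1 := 0)) = {a}" by (rule trivial_flat_point[of 0 1]) (use n in simp_all)
  obtain b where b: "trivial_flat (id(2 := 0)) = {b}" by (rule trivial_flat_point[of 0 2]) (use n in simp_all)
  obtain c where c: "trivial_flat (id(2 := 1)) = {c}" by (rule trivial_flat_point[of 1 2]) (use n in simp_all)
  obtain d where d: "trivial_flat (id(3 := 0)) = {d}" by (rule trivial_flat_point[of 0 3]) (use n in simp_all)
  obtain e where e: "trivial_flat (id(3 := 1)) = {e}" by (rule trivial_flat_point[of 1 3]) (use n in simp_all)
  obtain p where p: "trivial_flat (id(3 := 2)) = {p}" by (rule trivial_flat_point[of 2 3]) (use n in simp_all)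
  have ab: "a \<noteq> b" using trivial_flat_neqI0[OF in0(1), of "id(1 := 0)" "id(2 := 0)"] unfolding a b by simp
  have ac: "a \<noteq> c" using trivial_flat_neqI0[OF in0(1), of "id(1 := 0)" "id(2 := 1)"] unfolding a c by simp
  have bc: "b \<noteq> c" using trivial_flat_neqI0[OF in0(2), of "id(2 := 0)" "id(2 := 1)"] unfolding b c by simp
  have ad: "a \<noteq> d" using trivial_flat_neqI0[OF in0(1), of "id(1 := 0)" "id(3 := 0)"] unfolding a d by simp
  have ae: "a \<noteq> e" using trivial_flat_neqI0[OF in0(1), of "id(1 := 0)" "id(3 := 1)"] unfolding a e by simp
  have de: "d \<noteq> e" using trivial_flat_neqI0[OF in0(3), of "id(3 := 0)" "id(3 := 1)"] unfolding d e by simp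
  have bd: "b \<noteq> d" using trivial_flat_neqI0[OF in0(2), of "id(2 := 0)" "id(3 := 0)"] unfolding b d by simp
  have bp: "b \<noteq> p" using trivial_flat_neqI0[OF in0(2), of "id(2 := 0)" "id(3 := 2)"] unfolding b p by simp
  have dp: "d \<noteq> p" using trivial_flat_neqI0[OF in0(3), of "id(3 := 0)" "id(3 := 2)"] unfolding d p by simp
  have ce: "c \<noteq> e" using trivial_flat_neqI[OF in0(2) in0(1), of "id(2 := 1)" "id(3 := 1)"] unfolding c e by simp
  have cp: "c \<noteq> p" using trivial_flat_neqI[OF in0(2) in0(1), of "id(2 := 1)" "id(3 := 2)"] unfolding c p by simp
  have ep: "e \<noteq> p" using trivial_flat_neqI[OF in0(3) in0(1), of "id(3 := 1)" "id(3 := 2)"] unfolding e p by simp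
  have height: "flat_height (trivial_flat (id(k := i, l := j))) \<le> 2"
    if "k \<in> {1..n}" "l \<in> {1..n}" for i j k l
  proof -
    \<comment> \<open>Every colour other than \<open>k\<close> and \<open>l\<close> survives both
      updates, and the height counts the lost colours.\<close>
    have "{1..n} - {k, l} \<subseteq> id(k := i, l := j) ` {1..n} - {0}" by force
    then have "card ({1..n} - {k, l}) \<le> card (id(k := i, l := j) ` {1..n} - {0})"
      by (intro card_mono) auto
    moreover have "n - card {k, l} \<le> card ({1..n} - {k, l})"
      using diff_card_le_card_Diff[of "{k, l}" "{1..n}"] by simp
    moreover have "card {k, l} \<le> 2" by (simp add: card_insert_if)
    ultimately show ?thesis unfolding flat_height_trivial_flat by linarith
  qed
  \<comment> \<open>The merged triples are {0, 1, 2}, {0, 1, 3}, {0, 2, 3} and {1, 2, 3}.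
    \<open>L1\<close> is the line that \<open>L2\<close>, \<open>L3\<close> and \<open>L4\<close>
    cross, in \<open>a\<close>, \<open>b\<close> and \<open>c\<close> respectively.\<close>
  define L1 where "L1 = trivial_flat (id(1 := 0, 2 := 0))"
  define L2 where "L2 = trivial_flat (id(1 := 0, 3 := 0))"
  define L3 where "L3 = trivial_flat (id(2 := 0, 3 := 0))"
  define L4 where "L4 = trivial_flat (id(2 := 1, 3 := 1))"
  note L = L1_def L2_def L3_def L4_def
  have sub1: "{a} \<subseteq> L1" "{b} \<subseteq> L1" "{c} \<subseteq> L1"
    unfolding L a[symmetric] b[symmetric] c[symmetric] by (rule trivial_flat_mono; simp)+
  have sub2: "{a} \<subseteq> L2" "{d} \<subseteq> L2" "{e} \<subseteq> L2"
    unfolding L a[symmetric] d[symmetric] e[symmetric] by (rule trivial_flat_mono; simp)+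
  have sub3: "{b} \<subseteq> L3" "{d} \<subseteq> L3" "{p} \<subseteq> L3"
    unfolding L b[symmetric] d[symmetric] p[symmetric] by (rule trivial_flat_mono; simp)+
  have sub4: "{c} \<subseteq> L4" "{e} \<subseteq> L4" "{p} \<subseteq> L4"
    unfolding L c[symmetric] e[symmetric] p[symmetric] by (rule trivial_flat_mono; simp)+
  show False
  proof (rule no_line_with_three_crossings)
    show "L1 \<in> flats" "L2 \<in> flats" "L3 \<in> flats" "L4 \<in> flats"
      unfolding L by (rule trivial_flat(1))+
    show "flat_height L1 \<le> 2" "flat_height L2 \<le> 2" "flat_height L3 \<le> 2" "flat_height L4 \<le> 2"
      unfolding L using height in0 by blast+
    show "L1 \<noteq> L2" unfolding L by (rule trivial_flat_neqI0[OF in0(2)]) simp_all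
    show "L1 \<noteq> L3" unfolding L by (rule trivial_flat_neqI0[OF in0(1)]) simp_all
    show "L1 \<noteq> L4" unfolding L by (rule trivial_flat_neqI0[OF in0(1)]) simp_all
    show "card {a, b, c} = 3" "card {a, d, e} = 3" "card {b, d, p} = 3" "card {c, e, p} = 3"
      using ab ac bc ad ae de bd bp dp ce cp ep by simp_all
    show "{a, b, c} \<subseteq> L1" "{a, d, e} \<subseteq> L2" "{b, d, p} \<subseteq> L3" "{c, e, p} \<subseteq> L4"
      using sub1 sub2 sub3 sub4 by simp_all
  qed
qed

section \<open>The case of dimension two\<close>

lemma dimension_2_card:
  assumes n: "n = 2" and fin: "finite (carrier G)"
  shows "card U = card (carrier G) + 2"
proof -
  have U2: "flat_height U \<le> 2" using flat_height_le[of U] n by simp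
  \<comment> \<open>Two distinct points make every singleton a proper subset of \<open>U\<close>.
    Its height is then positive and strictly below \<open>flat_height U\<close>, which is at most 2;
    so the points of the matroid are exactly the flats of height one.\<close>
  obtain a where a: "a \<in> U" "trivial_flat (id(1 := 0)) = {a}"
    by (rule trivial_flat_point[of 0 1]) (use n in simp_all)
  obtain b where b: "b \<in> U" "trivial_flat (id(2 := 0)) = {b}"
    by (rule trivial_flat_point[of 0 2]) (use n in simp_all)
  have "trivial_flat (id(1 := 0)) \<noteq> trivial_flat (id(2 := 0))"
    by (rule trivial_flat_neqI0[of 1]) (use n in simp_all)
  then have "a \<noteq> b" unfolding a b by simp
  then have single: "{x} \<subset> U" if "x \<in> U" for x using a(1) b(1) that by blast
  have height1: "flat_height {x} = 1" if x: "x \<in> U" for x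
    using height_singleton_pos[OF x] strict[OF singleton_flat[OF x] U_flat single[OF x]] U2 by linarith
  have "bij_betw (\<lambda>x. f {x}) U {X \<in> carrier (dowling_lattice 2 G). dowling_height 2 X = 1}"
  proof (rule bij_betwI')
    fix x y assume xy: "x \<in> U" "y \<in> U"
    show "f {x} = f {y} \<longleftrightarrow> x = y"
      using inj_on_eq_iff[OF bij_betw_imp_inj_on[OF bij] singleton_flat[OF xy(1)] singleton_flat[OF xy(2)]]
      by simp
  next
    fix x assume x: "x \<in> U"
    show "f {x} \<in> {X \<in> carrier (dowling_lattice 2 G). dowling_height 2 X = 1}"
      using f_closed[OF singleton_flat[OF x]] height1[OF x] unfolding flat_height_def unfolding n by simp
  next
    fix X assume X: "X \<in> {X \<in> carrier (dowling_lattice 2 G). dowling_height 2 X = 1}"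
    then obtain F where F: "F \<in> flats" "X = f F"
      using bij_betw_imp_surj_on[OF bij] unfolding n by blast
    have h: "flat_height F = 1" using X F unfolding flat_height_def unfolding n by simp
    have "flat_height {} < flat_height {a}"
      by (rule strict[OF empty_flat singleton_flat[OF a(1)]]) auto
    then have "F \<noteq> {}" using h height1[OF a(1)] by auto
    then obtain y where "y \<in> U" "F = {y}" using height_one_flat[OF F(1)] h by (metis order_refl)
    then show "\<exists>x\<in>U. X = f {x}" using F by blast
  qed
  then show ?thesis using card_dowling_line_points[OF fin] by (simp add: bij_betw_same_card)
qed

lemma dimension_2_card_cov_Es:
  assumes n: "n = 2" and fin: "finite (carrier G)"
  shows "card (cov_Es U \<C>) = 1"
proof (rule card_cov_Es_of_line)
  show "flat_height U \<le> 2" using flat_height_le[of U] n by simp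
  have "carrier G \<noteq> {}" using one_closed by blast
  then have "0 < card (carrier G)" using fin by (simp add: card_gt_0_iff)
  then show "3 \<le> card U" using dimension_2_card[OF assms] by simp
qed

end

theorem theorem4p15:
  fixes U :: "'a set" and \<C> :: "'a set set" and G :: "('g, 'b) monoid_scheme"
    and m n k :: nat
  assumes "finite U" and "card U = m"
    and "covering U \<C>"
    and "\<not> (\<exists>u\<in>U. \<exists>v\<in>U. u \<noteq> v \<and> cov_meeting \<C> {u} = cov_meeting \<C> {v} \<and>
                card (cov_meeting \<C> {u}) = 1)"
    and "group G" and "finite (carrier G)"
    and "k = card (cov_Es U \<C>)"
    and "order_isomorphic (flat_lattice U \<C>) (dowling_lattice n G)"
  shows "(n \<in> {0, 1} \<or> n = 2) \<and> (n = 2 \<longrightarrow> m = card (carrier G) + 2 \<and> k = 1)"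
proof -
  obtain f where bij: "bij_betw f (carrier (flat_lattice U \<C>)) (carrier (dowling_lattice n G))"
    and emb: "order_emb (flat_lattice U \<C>) (dowling_lattice n G) f"
    using assms(8) unfolding order_isomorphic_def by blast
  interpret group G by fact
  interpret covering_dowling_iso U \<C> G n f
  proof
    show "finite U" "covering U \<C>" by fact+
    show "card (cov_meeting \<C> {u}) \<noteq> 1"
      if "u \<in> U" "v \<in> U" "u \<noteq> v" "cov_meeting \<C> {u} = cov_meeting \<C> {v}" for u v
      using assms(4) that by blast
    show "bij_betw f (matroid_flats U (transversal_indep U \<C>)) (carrier (dowling_lattice n G))"
      using bij by (simp add: flat_lattice_def)
    show "le (dowling_lattice n G) (f F) (f F') \<longleftrightarrow> F \<subseteq> F'"
      if "F \<in> matroid_flats U (transversal_indep U \<C>)" "F' \<in> matroid_flats U (transversal_indep U \<C>)" for F F'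
      using emb that unfolding order_emb_def by (simp add: flat_lattice_def)
  qed
  have "n \<in> {0, 1} \<or> n = 2" using dimension_le_2 by auto
  moreover have "m = card (carrier G) + 2 \<and> k = 1" if "n = 2"
    using dimension_2_card[OF that assms(6)] dimension_2_card_cov_Es[OF that assms(6)] assms(2,7) by simp
  ultimately show ?thesis by blast
qed

end
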